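(* Let $[\omega]^\omega\ni A\mapsto u_A$ be a function assigning to each infinite $A\subset\omega$ a weak $P$-point $u_A\in\omega^*$ with $A\in u_A$, such that the following holds: for every pair $\langle f_1,f_2\rangle$ of functions from $\omega$ to $\omega$ there exists $\mathcal A\subset[\omega]^\omega$ with $|\mathcal A|<\mathfrak c$ such that for all $A_1\in[\omega]^\omega\setminus\mathcal A$ and all $A_2\in[\omega]^\omega\setminus\{A_1\}$ we have $f_1(u_{A_1})\neq f_2(u_{A_2})$, provided that $f_1(u_{A_1}),f_2(u_{A_2})\in\omega^*$. Let $X=\omega\cup\{u_A: A\in[\omega]^\omega\}$, considered as a subspace of $\beta\omega$. Then $C_p(X\times X)$ does not have the Bounded Josefson--Nissenzweig Property, and hence it does not have the Josefson--Nissenzweig Property.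
   Context: $\beta\omega$ is the Čech--Stone compactification of the discrete space $\omega$, viewed as the space of ultrafilters on $\omega$; $\omega^*=\beta\omega\setminus\omega$ is the set of free ultrafilters. $[\omega]^\omega$ is the family of infinite subsets of $\omega$, and $\mathfrak c=2^\omega$ is the continuum. For $f:\omega\to\omega$ and an ultrafilter $u$, $f(u)=\{B\subset\omega: f^{-1}(B)\in u\}$. A point $p\in\omega^*$ is a weak $P$-point if $p$ is not in the closure of any countable set $D\subset\omega^*\setminus\{p\}$. A finitely supported signed measure on a Tychonoff space $Z$ is a finite linear combination $\mu=\sum_{x\in F}\alpha_x\delta_x$ of Dirac measures with $F\subset Z$ finite and $\alpha_x\in\mathbb{R}\setminus\{0\}$; $\|\mu\|=\sum_{x\in F}|\alpha_x|$ and $\mu(f)=\sum_{x\in F}\alpha_x f(x)$. $C_p(Z)$ (the space of continuous real-valued functions on $Z$ with the pointwise topology) has the Josefson--Nissenzweig Property if there is a sequence $(\mu_n)_{n\in\omega}$ of finitely supported signed measures on $Z$ with $\|\mu_n\|=1$ for all $n$ and $\mu_n(f)\to0$ for every continuous $f:Z\to\mathbb{R}$. It has the Bounded Josefson--Nissenzweig Property if there is such a sequence with $\|\mu_n\|=1$ for all $n$ and $\mu_n(f)\to 0$ for every bounded continuous $f:Z\to\mathbb{R}$. *)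

theory Defs
  imports "HOL-Analysis.Analysis" "HOL-Library.Equipollence"
begin

text \<open>
  Ultrafilters on \<open>\<omega>\<close> are elements of the library type \<open>nat filter\<close>: a set \<open>A\<close> belongs to
  \<open>u\<close> iff \<open>\<forall>\<^sub>F n in u. n \<in> A\<close>, the point \<open>n \<in> \<omega>\<close> is \<open>principal {n}\<close>, and the image
  \<open>f(u) = {B. f -` B \<in> u}\<close> is \<open>filtermap f u\<close> (see \<open>eventually_filtermap\<close>).
\<close>

definition beta_omega :: "nat filter set" where
  "beta_omega = {u. u \<noteq> bot \<and> (\<forall>A. (\<forall>\<^sub>F n in u. n \<in> A) \<or> (\<forall>\<^sub>F n in u. n \<notin> A))}"

definition omega_points :: "nat filter set" where
  "omega_points = range (\<lambda>n. principal {n})"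

definition omega_star :: "nat filter set" where
  "omega_star = beta_omega - omega_points"

definition beta_omega_topology :: "nat filter topology" where
  "beta_omega_topology =
     topology_generated_by (range (\<lambda>A. {u \<in> beta_omega. \<forall>\<^sub>F n in u. n \<in> A}))"

lemma topspace_beta_omega_topology [simp]: "topspace beta_omega_topology = beta_omega"
proof -
  have "\<forall>\<^sub>F n in u. n \<in> (UNIV :: nat set)" for u
    by simp
  then show ?thesis
    unfolding beta_omega_topology_def topology_generated_by_topspace by blast
qed

definition weak_P_point :: "nat filter \<Rightarrow> bool" where
  "weak_P_point p \<longleftrightarrow> p \<in> omega_star \<and>
     (\<forall>D. countable D \<and> D \<subseteq> omega_star - {p} \<longrightarrow> p \<notin> beta_omega_topology closure_of D)"

definition infinite_subsets :: "nat set set" where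
  "infinite_subsets = {A. infinite A}"

text \<open>
  The signed measure \<open>\<Sum>x\<in>F. \<alpha>\<^sub>x \<delta>\<^sub>x\<close> is represented by its coefficient function, which
  vanishes outside \<open>F\<close>; the support \<open>F\<close> is recovered as the set of nonzero coefficients.
\<close>

definition fs_supp :: "('a \<Rightarrow> real) \<Rightarrow> 'a set" where
  "fs_supp \<mu> = {x. \<mu> x \<noteq> 0}"

definition fs_measure_on :: "'a topology \<Rightarrow> ('a \<Rightarrow> real) \<Rightarrow> bool" where
  "fs_measure_on Z \<mu> \<longleftrightarrow> finite (fs_supp \<mu>) \<and> fs_supp \<mu> \<subseteq> topspace Z"

definition fs_norm :: "('a \<Rightarrow> real) \<Rightarrow> real" where
  "fs_norm \<mu> = (\<Sum>x\<in>fs_supp \<mu>. \<bar>\<mu> x\<bar>)"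

definition fs_integral :: "('a \<Rightarrow> real) \<Rightarrow> ('a \<Rightarrow> real) \<Rightarrow> real" where
  "fs_integral \<mu> f = (\<Sum>x\<in>fs_supp \<mu>. \<mu> x * f x)"

text \<open>
  Both properties of \<open>C\<^sub>p(Z)\<close> are expressed in terms of \<open>Z\<close>, which is meant to be Tychonoff.
\<close>

definition Cp_JNP :: "'a topology \<Rightarrow> bool" where
  "Cp_JNP Z \<longleftrightarrow> (\<exists>\<mu> :: nat \<Rightarrow> 'a \<Rightarrow> real.
     (\<forall>n. fs_measure_on Z (\<mu> n) \<and> fs_norm (\<mu> n) = 1) \<and>
     (\<forall>f. continuous_map Z euclideanreal f \<longrightarrow>
        (\<lambda>n. fs_integral (\<mu> n) f) \<longlonglongrightarrow> 0))"

definition Cp_BJNP :: "'a topology \<Rightarrow> bool" where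
  "Cp_BJNP Z \<longleftrightarrow> (\<exists>\<mu> :: nat \<Rightarrow> 'a \<Rightarrow> real.
     (\<forall>n. fs_measure_on Z (\<mu> n) \<and> fs_norm (\<mu> n) = 1) \<and>
     (\<forall>f. continuous_map Z euclideanreal f \<and> bounded (f ` topspace Z) \<longrightarrow>
        (\<lambda>n. fs_integral (\<mu> n) f) \<longlonglongrightarrow> 0))"

end

theory Submission
  imports Defs
begin

text \<open>
  Let \<open>\<mu>\<^sub>n\<close> be norm-one measures on \<open>X \<times> X\<close> that vanish in the limit on bounded continuous
  functions. Countable sets of weak P-points are discrete, so a gliding hump argument gives a Schur
  property for measures on \<open>X\<close>. Applied to slices, it makes the mass of \<open>{x} \<times> X\<close> and \<open>X \<times> {x}\<close>
  tend to 0, hence after passing to a subsequence \<open>\<mu>\<^sub>n\<close> is almost concentrated on \<open>K\<^sub>n \<times> K\<^sub>n\<close> with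
  \<open>K\<^sub>n\<close> finite, pairwise disjoint, and separated by disjoint clopen sets. Let \<open>f = n\<close> on the
  neighbourhood of \<open>K\<^sub>n\<close>. The hypothesis for the pair \<open>(f, f)\<close>, combined with an almost disjoint
  family of size continuum used to avoid the fewer than continuum many exceptional points, yields an
  infinite set of indices along which a sum of locally constant functions living on the
  neighbourhoods of \<open>K\<^sub>n \<times> K\<^sub>n\<close> is continuous. Testing against such a function shows that the
  off-diagonal mass tends to 0, and the diagonal part is excluded by the Schur property on \<open>X\<close>.
\<close>

abbreviation (input) mem_filter :: "nat set \<Rightarrow> nat filter \<Rightarrow> bool" (infix "\<in>\<^sub>F" 50) where
  "A \<in>\<^sub>F x \<equiv> \<forall>\<^sub>F n in x. n \<in> A"

section \<open>Ultrafilters on the natural numbers\<close>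

lemma ultrafilter_mono: "A \<in>\<^sub>F x \<Longrightarrow> A \<subseteq> B \<Longrightarrow> B \<in>\<^sub>F x"
  by (erule eventually_mono) auto

lemma ultrafilter_Int: "A \<in>\<^sub>F x \<Longrightarrow> B \<in>\<^sub>F x \<Longrightarrow> A \<inter> B \<in>\<^sub>F x"
  by (simp add: eventually_conj)

lemma ultrafilter_disjoint:
  assumes "x \<in> beta_omega" "A \<in>\<^sub>F x" "B \<in>\<^sub>F x" shows "A \<inter> B \<noteq> {}"
proof
  assume "A \<inter> B = {}"
  then have "eventually (\<lambda>_. False) x"
    using ultrafilter_Int[OF assms(2,3)] by simp
  then show False
    using assms(1) by (simp add: beta_omega_def eventually_False)
qed

lemma ultrafilter_Compl:
  assumes "x \<in> beta_omega" shows "- A \<in>\<^sub>F x \<longleftrightarrow> \<not> A \<in>\<^sub>F x"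
  using assms ultrafilter_disjoint[OF assms, of A "-A"] by (auto simp: beta_omega_def)

lemma ultrafilter_finite_UN:
  assumes "x \<in> beta_omega" "finite K" "(\<Union>a\<in>K. U a) \<in>\<^sub>F x"
  shows "\<exists>a\<in>K. U a \<in>\<^sub>F x"
proof (rule ccontr)
  assume "\<not> ?thesis"
  then have "\<forall>a\<in>K. \<forall>\<^sub>F n in x. n \<in> - U a"
    using ultrafilter_Compl[OF assms(1)] by blast
  then have "\<forall>\<^sub>F n in x. \<forall>a\<in>K. n \<in> - U a"
    by (rule eventually_ball_finite[OF assms(2)])
  then have "- (\<Union>a\<in>K. U a) \<in>\<^sub>F x"
    by (rule eventually_mono) auto
  then show False
    using assms(3) ultrafilter_Compl[OF assms(1)] by blast
qed

lemma ultrafilter_singleton: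
  assumes "x \<in> beta_omega" "{i} \<in>\<^sub>F x" shows "x = principal {i}"
proof -
  have "eventually P x \<longleftrightarrow> P i" for P
  proof
    assume "eventually P x"
    then have "Collect P \<in>\<^sub>F x" by simp
    from ultrafilter_disjoint[OF assms(1) this assms(2)] show "P i" by auto
  next
    assume "P i"
    then show "eventually P x"
      using assms(2) by (auto elim: eventually_mono)
  qed
  then show ?thesis
    by (auto simp: filter_eq_iff eventually_principal)
qed

lemma principal_singleton_inject: "principal {i} = principal {j} \<longleftrightarrow> i = j"
  by (auto simp: filter_eq_iff eventually_principal dest: spec[of _ "(=) _"])

lemma omega_points_subset_beta_omega: "omega_points \<subseteq> beta_omega"
  by (auto simp: omega_points_def beta_omega_def eventually_principal principal_eq_bot_iff)

lemma omega_starD: "x \<in> omega_star \<Longrightarrow> x \<in> beta_omega"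
  by (simp add: omega_star_def)

lemma weak_P_pointD: "weak_P_point x \<Longrightarrow> x \<in> omega_star"
  by (simp add: weak_P_point_def)

lemma omega_star_finite:
  assumes "x \<in> omega_star" "finite F" shows "\<not> F \<in>\<^sub>F x"
proof
  assume "F \<in>\<^sub>F x"
  then have "(\<Union>i\<in>F. {i}) \<in>\<^sub>F x" by simp
  then obtain i where "{i} \<in>\<^sub>F x"
    using ultrafilter_finite_UN[OF omega_starD[OF assms(1)] assms(2)] by blast
  then have "x \<in> omega_points"
    using ultrafilter_singleton[OF omega_starD[OF assms(1)]] by (auto simp: omega_points_def)
  then show False
    using assms(1) by (simp add: omega_star_def)
qed

lemma ultrafilter_neq:
  assumes "x \<in> beta_omega" "y \<in> beta_omega" "x \<noteq> y"
  shows "\<exists>A. A \<in>\<^sub>F x \<and> - A \<in>\<^sub>F y"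
proof -
  obtain P where P: "eventually P x \<noteq> eventually P y"
    using assms(3) by (auto simp: filter_eq_iff)
  then have "(Collect P \<in>\<^sub>F x) \<noteq> (Collect P \<in>\<^sub>F y)" by simp
  then show ?thesis
    using ultrafilter_Compl[OF assms(1), of "Collect P"] ultrafilter_Compl[OF assms(2), of "Collect P"]
      double_complement by metis
qed

lemma filtermap_beta_omega:
  assumes "x \<in> beta_omega" shows "filtermap f x \<in> beta_omega"
  using assms unfolding beta_omega_def
  by (auto simp: eventually_filtermap filtermap_bot_iff vimage_def[symmetric]
        dest: spec[of _ "f -` _"])

section \<open>The clopen base of the topology and the isolation of weak P-points\<close>

lemma openin_beta_omega_basic: "openin beta_omega_topology {x \<in> beta_omega. A \<in>\<^sub>F x}"
  unfolding beta_omega_topology_def by (rule topology_generated_by_Basis) blast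

text \<open>The generating sets are closed under finite intersections, because an ultrafilter
  contains \<open>A\<close> and \<open>B\<close> iff it contains their intersection. Hence the
  generating family is already a base, which the induction over generated open sets makes
  explicit.\<close>

lemma openin_beta_omega_imp_basic:
  assumes "openin beta_omega_topology V" "x \<in> V"
  shows "\<exists>A. A \<in>\<^sub>F x \<and> {y \<in> beta_omega. A \<in>\<^sub>F y} \<subseteq> V"
proof -
  have "generate_topology_on (range (\<lambda>A. {u \<in> beta_omega. A \<in>\<^sub>F u})) V"
    using assms(1) by (simp add: beta_omega_topology_def openin_topology_generated_by_iff)
  then show ?thesis
    using assms(2)
  proof (induction arbitrary: x)
    case (Int V W)
    then obtain A B where "A \<in>\<^sub>F x" "{y \<in> beta_omega. A \<in>\<^sub>F y} \<subseteq> V"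
      "B \<in>\<^sub>F x" "{y \<in> beta_omega. B \<in>\<^sub>F y} \<subseteq> W" by blast
    then show ?case
      by (intro exI[of _ "A \<inter> B"]) (auto simp: eventually_conj_iff)
  next
    case (UN \<V>)
    then show ?case by (meson Sup_upper UnionE subset_trans)
  qed auto
qed

text \<open>Closure is turned into a statement about members of \<open>x\<close>. Only free
  ultrafilters are allowed in \<open>D\<close>: the whole of \<omega> accumulates at
  \<open>x\<close>, so principal points have to be handled by separate thinning arguments.\<close>

lemma weak_P_point_isolated:
  assumes "weak_P_point x" "countable D" "D \<subseteq> omega_star - {x}"
  shows "\<exists>B. B \<in>\<^sub>F x \<and> (\<forall>y\<in>D. \<not> B \<in>\<^sub>F y)"
proof -
  have "x \<notin> beta_omega_topology closure_of D" "x \<in> beta_omega"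
    using assms omega_starD by (auto simp: weak_P_point_def)
  then obtain V where "openin beta_omega_topology V" "x \<in> V" "\<forall>y\<in>D. y \<notin> V"
    by (auto simp: in_closure_of)
  then show ?thesis
    using openin_beta_omega_imp_basic[of V x] assms(3) omega_starD by blast
qed

section \<open>Almost disjoint families\<close>

text \<open>The branch of the full binary tree that follows the characteristic function of
  \<open>S\<close>. Its nodes, the finite initial segments, are coded by numbers; the level
  \<open>n\<close> is part of the code, so the branch is infinite even when \<open>S\<close> is
  finite.\<close>

definition branch :: "nat set \<Rightarrow> nat set" where
  "branch S = range (\<lambda>n. prod_encode (n, set_encode (S \<inter> {..<n})))"

lemma infinite_branch: "infinite (branch S)"
  unfolding branch_def by (rule range_inj_infinite) (auto intro!: injI)

text \<open>Once \<open>S\<close> and \<open>T\<close> differ at \<open>k\<close>, the two branches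
  have no common node at any level above \<open>k\<close>.\<close>

lemma finite_branch_Int:
  assumes "S \<noteq> T" shows "finite (branch S \<inter> branch T)"
proof -
  obtain k where k: "k \<in> S \<longleftrightarrow> k \<notin> T" using assms by blast
  have "branch S \<inter> branch T \<subseteq> (\<lambda>n. prod_encode (n, set_encode (S \<inter> {..<n}))) ` {..k}"
  proof
    fix z assume "z \<in> branch S \<inter> branch T"
    then obtain n where n: "z = prod_encode (n, set_encode (S \<inter> {..<n}))"
      "set_encode (S \<inter> {..<n}) = set_encode (T \<inter> {..<n})"
      by (auto simp: branch_def)
    then have "S \<inter> {..<n} = T \<inter> {..<n}" by (simp add: set_encode_eq)
    then have "\<not> k < n" using k by blast
    then show "z \<in> (\<lambda>n. prod_encode (n, set_encode (S \<inter> {..<n}))) ` {..k}"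
      using n(1) by auto
  qed
  then show ?thesis by (rule finite_subset) simp
qed

text \<open>There are continuum many pairwise almost disjoint branches, and one \<open>a\<close> can
  satisfy \<open>P a\<close> for at most one of them. If every branch were hit, choosing a culprit
  for each would inject the continuum into \<A>. Typically \<open>P a S\<close> says that
  \<open>S\<close> belongs to a free ultrafilter attached to \<open>a\<close>.\<close>

lemma ex_infinite_avoiding:
  fixes P :: "'a \<Rightarrow> nat set \<Rightarrow> bool"
  assumes "\<A> \<prec> (UNIV :: nat set set)"
    and "\<And>a S T. a \<in> \<A> \<Longrightarrow> P a S \<Longrightarrow> P a T \<Longrightarrow> infinite (S \<inter> T)"
  shows "\<exists>I. infinite I \<and> (\<forall>a\<in>\<A>. \<not> P a I)"
proof (rule ccontr)
  assume "\<not> ?thesis"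
  then have "\<forall>S. \<exists>a\<in>\<A>. P a (branch S)"
    using infinite_branch by blast
  then obtain g where g: "\<And>S. g S \<in> \<A>" "\<And>S. P (g S) (branch S)"
    by metis
  have "inj g"
    by (rule injI) (metis assms(2) finite_branch_Int g)
  then have "(UNIV :: nat set set) \<lesssim> \<A>"
    unfolding lepoll_def using g(1) by (intro exI[of _ g]) auto
  then show False
    using assms(1) by (meson lesspoll_def lepoll_antisym)
qed

lemma countable_lesspoll_continuum:
  assumes "countable A" shows "A \<prec> (UNIV :: nat set set)"
proof -
  have "A \<lesssim> (UNIV :: nat set)"
    using assms by (auto simp: countable_def lepoll_def)
  moreover have "(UNIV :: nat set) \<prec> (UNIV :: nat set set)"
    using lesspoll_Pow_self[of "UNIV :: nat set"] by simp
  ultimately show ?thesis by (rule lesspoll_trans1)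
qed

section \<open>Gliding humps\<close>

lemma not_tendsto_zeroE:
  fixes g :: "nat \<Rightarrow> real"
  assumes "\<not> g \<longlonglongrightarrow> 0"
  obtains \<epsilon> r where "\<epsilon> > 0" "strict_mono (r :: nat \<Rightarrow> nat)" "\<And>n. \<epsilon> \<le> \<bar>g (r n)\<bar>"
proof -
  obtain \<epsilon> where \<epsilon>: "\<epsilon> > 0" "\<forall>N. \<exists>n\<ge>N. \<epsilon> \<le> \<bar>g n\<bar>"
    using assms by (auto simp: LIMSEQ_def not_less)
  then have "infinite {n. \<epsilon> \<le> \<bar>g n\<bar>}"
    unfolding infinite_nat_iff_unbounded_le by auto
  then obtain r where "strict_mono (r :: nat \<Rightarrow> nat)" "\<forall>n. r n \<in> {n. \<epsilon> \<le> \<bar>g n\<bar>}"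
    using infinite_enumerate by blast
  with \<epsilon>(1) show ?thesis by (intro that) auto
qed

lemma tendsto_zero_infinite_contradiction:
  fixes g :: "nat \<Rightarrow> real"
  assumes "g \<longlonglongrightarrow> 0" "strict_mono (r :: nat \<Rightarrow> nat)" "infinite I" "\<delta> > 0"
    and "\<And>n. n \<in> I \<Longrightarrow> \<delta> \<le> \<bar>g (r n)\<bar>"
  shows False
proof -
  have "(g \<circ> r) \<longlonglongrightarrow> 0" using assms(1,2) by (rule LIMSEQ_subseq_LIMSEQ)
  then obtain N where "\<forall>n\<ge>N. \<bar>g (r n)\<bar> < \<delta>"
    using \<open>\<delta> > 0\<close> by (auto simp: LIMSEQ_def)
  moreover obtain n where "n \<ge> N" "n \<in> I"
    using assms(3) unfolding infinite_nat_iff_unbounded_le by blast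
  ultimately show False using assms(5) by fastforce
qed

text \<open>Think of \<open>T n\<close> as the support of the n-th measure and of
  \<open>M n F\<close> as its mass on \<open>F\<close>. Each new index is taken so large that the
  mass on the union of all earlier supports is below \<epsilon>; this union is \<open>G n\<close>,
  and removing it leaves disjoint remainders.\<close>

lemma gliding_hump:
  fixes T :: "nat \<Rightarrow> 'a set" and M :: "nat \<Rightarrow> 'a set \<Rightarrow> real"
  assumes "\<And>n. finite (T n)" "\<And>F. finite F \<Longrightarrow> (\<lambda>n. M n F) \<longlonglongrightarrow> 0" "\<epsilon> > 0"
  shows "\<exists>s G. strict_mono (s :: nat \<Rightarrow> nat) \<and> (\<forall>n. M (s n) (G n) < \<epsilon>) \<and>
           disjoint_family (\<lambda>n. T (s n) - G n)"
proof -
  \<comment> \<open>The conjunct \<open>True\<close> is the pointwise condition of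
    \<open>dependent_nat_choice\<close>; all the content lies in the relation between consecutive
    indices.\<close>
  have "\<exists>r :: nat \<Rightarrow> nat. \<forall>n. True \<and> (r n < r (Suc n) \<and> M (r (Suc n)) (\<Union>k\<le>r n. T k) < \<epsilon>)"
  proof (rule dependent_nat_choice)
    fix m n :: nat
    have "(\<lambda>n. M n (\<Union>k\<le>m. T k)) \<longlonglongrightarrow> 0" using assms(1,2) by blast
    then obtain N where "\<forall>n\<ge>N. M n (\<Union>k\<le>m. T k) < \<epsilon>"
      using \<open>\<epsilon> > 0\<close> by (fastforce simp: LIMSEQ_def)
    then show "\<exists>k. True \<and> (m < k \<and> M k (\<Union>k\<le>m. T k) < \<epsilon>)"
      by (intro exI[of _ "max N (Suc m)"]) auto
  qed auto
  then obtain r :: "nat \<Rightarrow> nat" where r: "\<And>n. r n < r (Suc n)"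
    "\<And>n. M (r (Suc n)) (\<Union>k\<le>r n. T k) < \<epsilon>" by blast
  have mono: "strict_mono r" using r(1) by (simp add: strict_mono_Suc_iff)
  have disj: "(T (r (Suc m)) - (\<Union>k\<le>r m. T k)) \<inter> (T (r (Suc n)) - (\<Union>k\<le>r n. T k)) = {}"
    if "m < n" for m n
  proof -
    have "r (Suc m) \<le> r n" using mono that by (simp add: strict_mono_less_eq)
    then show ?thesis by blast
  qed
  have "disjoint_family (\<lambda>n. T (r (Suc n)) - (\<Union>k\<le>r n. T k))"
    unfolding disjoint_family_on_def
  proof (intro ballI impI)
    fix m n :: nat assume "m \<noteq> n"
    then show "(T (r (Suc m)) - (\<Union>k\<le>r m. T k)) \<inter> (T (r (Suc n)) - (\<Union>k\<le>r n. T k)) = {}"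
      using disj[of m n] disj[of n m] by (metis Int_commute linorder_neqE_nat)
  qed
  moreover have "strict_mono (\<lambda>n. r (Suc n))" using r(1) by (simp add: strict_mono_Suc_iff)
  \<comment> \<open>The start \<open>r 0\<close> is arbitrary and comes with no smallness, so the
    subsequence begins at \<open>r (Suc 0)\<close>.\<close>
  ultimately show ?thesis using r(2)
    by (intro exI[of _ "\<lambda>n. r (Suc n)"] exI[of _ "\<lambda>n. \<Union>k\<le>r n. T k"]) auto
qed

section \<open>Disjoint clopen neighbourhoods for the points of disjoint finite sets\<close>

lemma weak_P_points_disjoint_neighbourhoods:
  assumes "countable W" "\<And>x. x \<in> W \<Longrightarrow> weak_P_point x"
  shows "\<exists>U. (\<forall>x\<in>W. U x \<in>\<^sub>F x) \<and> (\<forall>x\<in>W. \<forall>y\<in>W. x \<noteq> y \<longrightarrow> U x \<inter> U y = {})"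
proof -
  have "\<forall>x\<in>W. \<exists>B. B \<in>\<^sub>F x \<and> (\<forall>y\<in>W - {x}. \<not> B \<in>\<^sub>F y)"
    using assms weak_P_pointD by (intro ballI weak_P_point_isolated) (auto intro: countable_subset)
  then obtain B where B: "\<And>x. x \<in> W \<Longrightarrow> B x \<in>\<^sub>F x"
    "\<And>x y. x \<in> W \<Longrightarrow> y \<in> W \<Longrightarrow> x \<noteq> y \<Longrightarrow> \<not> B x \<in>\<^sub>F y"
    by (metis Diff_iff singletonD)
  define i where "i = to_nat_on W"
  have inj: "inj_on i W" unfolding i_def using assms(1) by (rule inj_on_to_nat_on)
  \<comment> \<open>Disjointification along an enumeration of \<open>W\<close>. Only finitely many
    sets \<open>B y\<close> are removed from \<open>B x\<close>, and none of them belongs to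
    \<open>x\<close>, so the difference still does.\<close>
  define U where "U x = B x - (\<Union>y\<in>{y\<in>W. i y < i x}. B y)" for x
  have "U x \<in>\<^sub>F x" if x: "x \<in> W" for x
  proof -
    have beta: "x \<in> beta_omega" using assms(2) x weak_P_pointD omega_starD by blast
    have "finite (i ` {y\<in>W. i y < i x})" by (rule finite_subset[of _ "{..<i x}"]) auto
    then have "finite {y\<in>W. i y < i x}"
      by (rule finite_imageD) (use inj in \<open>auto intro: inj_on_subset\<close>)
    then have "\<not> (\<Union>y\<in>{y\<in>W. i y < i x}. B y) \<in>\<^sub>F x"
      using ultrafilter_finite_UN[OF beta, of "{y\<in>W. i y < i x}" B] B(2) x by blast
    then have "B x \<inter> - (\<Union>y\<in>{y\<in>W. i y < i x}. B y) \<in>\<^sub>F x"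
      using ultrafilter_Compl[OF beta] B(1)[OF x] by (intro ultrafilter_Int) blast+
    then show ?thesis unfolding U_def Diff_eq .
  qed
  moreover have "U x \<inter> U y = {}" if "x \<in> W" "y \<in> W" "x \<noteq> y" for x y
  proof -
    have "i x \<noteq> i y" using inj that by (auto dest: inj_onD)
    then consider "i x < i y" | "i y < i x" by linarith
    then show ?thesis using that(1,2) unfolding U_def by cases blast+
  qed
  ultimately show ?thesis by blast
qed

text \<open>The weak P-points involved form a countable set and can be separated from each other,
  but the principal points may accumulate at them. Passing to a subsequence removes this
  obstruction: the remaining principal points form a set that belongs to none of the weak P-points,
  and can be cut out of their neighbourhoods.\<close>

lemma finite_sets_disjoint_neighbourhoods:
  assumes "\<And>n. finite (K n)" "disjoint_family K"
    and "\<And>n x. x \<in> K n \<Longrightarrow> x \<in> omega_points \<or> weak_P_point x"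
  shows "\<exists>r U. strict_mono (r :: nat \<Rightarrow> nat) \<and> (\<forall>n. \<forall>x\<in>K (r n). U x \<in>\<^sub>F x) \<and>
           (\<forall>x\<in>(\<Union>n. K (r n)). \<forall>y\<in>(\<Union>n. K (r n)). x \<noteq> y \<longrightarrow> U x \<inter> U y = {})"
proof -
  define W where "W = {x\<in>(\<Union>n. K n). weak_P_point x}"
  define T where "T n = {i. principal {i} \<in> K n}" for n
  have "countable W"
  proof (rule countable_subset)
    show "W \<subseteq> (\<Union>n. K n)" by (auto simp: W_def)
  qed (use assms(1) in \<open>auto intro: countable_finite\<close>)
  have Wbeta: "x \<in> omega_star" if "x \<in> W" for x
    using that weak_P_pointD by (auto simp: W_def)
  have Tfin: "finite (T n)" for n
  proof -
    have "finite ((\<lambda>i. principal {i}) ` T n)"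
      by (rule finite_subset[OF _ assms(1)[of n]]) (auto simp: T_def)
    then show ?thesis by (rule finite_imageD) (auto intro!: inj_onI simp: principal_singleton_inject)
  qed
  have Tdisj: "m = n" if "i \<in> T m" "i \<in> T n" for i m n
    using that assms(2) unfolding T_def disjoint_family_on_def by blast
  \<comment> \<open>Since the \<open>T n\<close> are disjoint, index sets \<open>R\<close> and
    \<open>S\<close> whose unions lie in the same \<open>x\<close> give a union over their
    intersection that also lies in \<open>x\<close>. As \<open>x\<close> is free and each
    \<open>T n\<close> is finite, that intersection is infinite.\<close>
  have "\<exists>I. infinite I \<and> (\<forall>x\<in>W. \<not> (\<Union>n\<in>I. T n) \<in>\<^sub>F x)"
  proof (rule ex_infinite_avoiding)
    show "W \<prec> (UNIV :: nat set set)"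
      using \<open>countable W\<close> by (rule countable_lesspoll_continuum)
    fix x R S assume x: "x \<in> W" "(\<Union>n\<in>R. T n) \<in>\<^sub>F x" "(\<Union>n\<in>S. T n) \<in>\<^sub>F x"
    have "(\<Union>n\<in>R \<inter> S. T n) \<in>\<^sub>F x"
      by (rule ultrafilter_mono[OF ultrafilter_Int[OF x(2,3)]]) (use Tdisj in blast)
    then show "infinite (R \<inter> S)"
      using omega_star_finite[OF Wbeta[OF x(1)]] Tfin by blast
  qed
  then obtain I where I: "infinite I" "\<And>x. x \<in> W \<Longrightarrow> \<not> (\<Union>n\<in>I. T n) \<in>\<^sub>F x" by blast
  obtain r :: "nat \<Rightarrow> nat" where r: "strict_mono r" "\<And>n. r n \<in> I"
    using infinite_enumerate[OF I(1)] by blast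
  obtain V where V: "\<And>x. x \<in> W \<Longrightarrow> V x \<in>\<^sub>F x"
    "\<And>x y. x \<in> W \<Longrightarrow> y \<in> W \<Longrightarrow> x \<noteq> y \<Longrightarrow> V x \<inter> V y = {}"
    using weak_P_points_disjoint_neighbourhoods[OF \<open>countable W\<close>] by (auto simp: W_def) blast
  \<comment> \<open>For a principal point the second alternative is the singleton of its generator,
    which for the retained points lies in the set removed in the first alternative.\<close>
  define U where "U x = (if x \<in> W then V x - (\<Union>n\<in>I. T n) else {i. x = principal {i}})" for x
  have W: "U x = V x - (\<Union>n\<in>I. T n)" if "x \<in> W" for x using that by (simp add: U_def)
  have notW: "\<exists>i\<in>(\<Union>n\<in>I. T n). x = principal {i} \<and> U x = {i}" if "x \<in> K (r n)" "x \<notin> W" for x n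
  proof -
    have "x \<in> omega_points" using that assms(3) by (auto simp: W_def)
    then obtain i where "x = principal {i}" by (auto simp: omega_points_def)
    then show ?thesis using that r(2)[of n] by (auto simp: U_def T_def principal_singleton_inject)
  qed
  have "U x \<in>\<^sub>F x" if "x \<in> K (r n)" for n x
  proof (cases "x \<in> W")
    case True
    then have "V x \<inter> - (\<Union>n\<in>I. T n) \<in>\<^sub>F x"
      using ultrafilter_Compl[OF omega_starD[OF Wbeta[OF True]]] V(1) I(2)
      by (intro ultrafilter_Int) blast+
    then show ?thesis unfolding W[OF True] Diff_eq .
  next
    case False
    then show ?thesis using notW[OF that] by (auto simp: eventually_principal)
  qed
  moreover have "U x \<inter> U y = {}" if "x \<in> K (r m)" "y \<in> K (r n)" "x \<noteq> y" for x y m n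
    using notW[OF that(1)] notW[OF that(2)] W[of x] W[of y] V(2)[of x y] that(3)
    by (cases "x \<in> W"; cases "y \<in> W") auto
  ultimately show ?thesis using r(1) by blast
qed

lemma gliding_hump_disjoint_neighbourhoods:
  fixes T :: "nat \<Rightarrow> nat filter set" and M :: "nat \<Rightarrow> nat filter set \<Rightarrow> real"
  assumes "\<And>n. finite (T n)" "\<And>F. finite F \<Longrightarrow> (\<lambda>n. M n F) \<longlonglongrightarrow> 0" "\<epsilon> > 0"
    and "\<And>n x. x \<in> T n \<Longrightarrow> x \<in> omega_points \<or> weak_P_point x"
  shows "\<exists>s G U. strict_mono (s :: nat \<Rightarrow> nat) \<and> (\<forall>n. M (s n) (G n) < \<epsilon>) \<and>
           disjoint_family (\<lambda>n. T (s n) - G n) \<and> (\<forall>n. \<forall>x\<in>T (s n) - G n. U x \<in>\<^sub>F x) \<and>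
           (\<forall>x\<in>(\<Union>n. T (s n) - G n). \<forall>y\<in>(\<Union>n. T (s n) - G n). x \<noteq> y \<longrightarrow> U x \<inter> U y = {})"
proof -
  have "\<exists>s G. strict_mono (s :: nat \<Rightarrow> nat) \<and> (\<forall>n. M (s n) (G n) < \<epsilon>) \<and>
      disjoint_family (\<lambda>n. T (s n) - G n)"
    by (rule gliding_hump) (fact assms(1-3))+
  then obtain s G where s: "strict_mono (s :: nat \<Rightarrow> nat)" "\<forall>n. M (s n) (G n) < \<epsilon>"
    "disjoint_family (\<lambda>n. T (s n) - G n)"
    by (elim exE conjE)
  have "\<exists>r U. strict_mono (r :: nat \<Rightarrow> nat) \<and> (\<forall>n. \<forall>x\<in>T (s (r n)) - G (r n). U x \<in>\<^sub>F x) \<and>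
      (\<forall>x\<in>(\<Union>n. T (s (r n)) - G (r n)). \<forall>y\<in>(\<Union>n. T (s (r n)) - G (r n)). x \<noteq> y \<longrightarrow> U x \<inter> U y = {})"
    by (rule finite_sets_disjoint_neighbourhoods) (use assms(1,4) s(3) in auto)
  then obtain r U where r: "strict_mono (r :: nat \<Rightarrow> nat)"
    "\<forall>n. \<forall>x\<in>T (s (r n)) - G (r n). U x \<in>\<^sub>F x"
    "\<forall>x\<in>(\<Union>n. T (s (r n)) - G (r n)). \<forall>y\<in>(\<Union>n. T (s (r n)) - G (r n)). x \<noteq> y \<longrightarrow> U x \<inter> U y = {}"
    by (elim exE conjE)
  show ?thesis
  proof (intro exI conjI)
    show "strict_mono (\<lambda>n. s (r n))" using s(1) r(1) by (simp add: strict_mono_def)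
    show "disjoint_family (\<lambda>n. T (s (r n)) - G (r n))"
      using s(3) r(1) by (auto simp: disjoint_family_on_def strict_mono_eq)
    show "\<forall>n. M (s (r n)) (G (r n)) < \<epsilon>" using s(2) by blast
  qed (fact r(2,3))+
qed

section \<open>The Schur property for measures on weak P-points\<close>

text \<open>At a weak P-point \<open>x\<close>, a clopen set isolates \<open>x\<close> from all
  other free points of the supports; the remaining competition comes from principal points, whose
  coefficients are already known to vanish in the limit and can be made into disjoint humps. The
  sets \<open>S n\<close> may exceed the supports, so that the lemma also applies to projected
  measures, where coefficients can cancel.\<close>

lemma null_measures_pointwise:
  fixes \<nu> :: "nat \<Rightarrow> nat filter \<Rightarrow> real"
  assumes fin: "\<And>n. finite (S n)"
    and pts: "\<And>n x. x \<in> S n \<Longrightarrow> x \<in> omega_points \<or> weak_P_point x"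
    and zero: "\<And>n x. x \<notin> S n \<Longrightarrow> \<nu> n x = 0"
    and conv: "\<And>B. (\<lambda>n. \<Sum>x\<in>S n. \<nu> n x * of_bool (B \<in>\<^sub>F x)) \<longlonglongrightarrow> 0"
  shows "(\<lambda>n. \<nu> n x) \<longlonglongrightarrow> 0"
proof -
  have beta: "y \<in> beta_omega" if "y \<in> S n" for y n
    using pts[OF that] omega_points_subset_beta_omega weak_P_pointD omega_starD by blast
  have point: "(\<lambda>n. \<nu> n y) \<longlonglongrightarrow> 0" if y: "y \<in> omega_points" for y
  proof -
    obtain i where i: "y = principal {i}" using y by (auto simp: omega_points_def)
    have "(\<Sum>z\<in>S n. \<nu> n z * of_bool ({i} \<in>\<^sub>F z)) = \<nu> n y" for n
    proof -
      have "{i} \<in>\<^sub>F z \<longleftrightarrow> y = z" if "z \<in> S n" for z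
        using ultrafilter_singleton[OF beta[OF that], of i] i by (auto simp: eventually_principal)
      then have "(\<Sum>z\<in>S n. \<nu> n z * of_bool ({i} \<in>\<^sub>F z)) = (\<Sum>z\<in>S n. if y = z then \<nu> n z else 0)"
        by (intro sum.cong) auto
      also have "\<dots> = \<nu> n y" using fin[of n] zero[of y n] by simp
      finally show ?thesis .
    qed
    then show ?thesis using conv[of "{i}"] by simp
  qed
  consider "x \<in> omega_points" | "weak_P_point x" | "x \<notin> omega_points" "\<not> weak_P_point x" by blast
  then show ?thesis
  proof cases
    case 3
    then have "\<nu> n x = 0" for n using pts zero by blast
    then show ?thesis by simp
  next
    case 2
    show ?thesis
    proof (rule ccontr)
      assume "\<not> ?thesis"
      then obtain \<epsilon> r where r: "\<epsilon> > 0" "strict_mono (r :: nat \<Rightarrow> nat)" "\<And>n. \<epsilon> \<le> \<bar>\<nu> (r n) x\<bar>"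
        by (rule not_tendsto_zeroE) blast
      have xS: "x \<in> S (r n)" for n using zero[of x "r n"] r(1) r(3)[of n] by (cases "x \<in> S (r n)") auto
      have "countable ((\<Union>n. S n) \<inter> omega_star - {x})"
        by (rule countable_subset[of _ "\<Union>n. S n"]) (use fin in \<open>auto intro: countable_finite\<close>)
      then obtain B where B: "B \<in>\<^sub>F x"
        "\<And>y. y \<in> (\<Union>n. S n) \<inter> omega_star - {x} \<Longrightarrow> \<not> B \<in>\<^sub>F y"
        using weak_P_point_isolated[OF 2] by (metis Diff_mono inf.cobounded2 subset_refl)
      have B_points: "y \<in> omega_points" if "y \<in> S n" "y \<noteq> x" "B \<in>\<^sub>F y" for y n
        using that B(2) pts weak_P_pointD by blast
      \<comment> \<open>By the choice of \<open>B\<close>, these are the only points of the support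
        other than \<open>x\<close> that an indicator of a subset of \<open>B\<close> can
        see.\<close>
      define T where "T n = S (r n) \<inter> {y\<in>omega_points. B \<in>\<^sub>F y}" for n
      define M where "M n F = (\<Sum>y\<in>T n \<inter> F. \<bar>\<nu> (r n) y\<bar>)" for n F
      have "(\<lambda>n. M n F) \<longlonglongrightarrow> 0" if "finite F" for F
      proof -
        have "M n F = (\<Sum>y\<in>F \<inter> {y\<in>omega_points. B \<in>\<^sub>F y}. \<bar>\<nu> (r n) y\<bar>)" for n
          unfolding M_def T_def using that zero by (intro sum.mono_neutral_left) auto
        moreover have "(\<lambda>n. \<nu> (r n) y) \<longlonglongrightarrow> 0" if "y \<in> omega_points" for y
          using LIMSEQ_subseq_LIMSEQ[OF point[OF that] r(2)] by (simp add: o_def)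
        ultimately show ?thesis by (auto intro!: tendsto_null_sum tendsto_rabs_zero)
      qed
      then have "\<exists>s G. strict_mono (s :: nat \<Rightarrow> nat) \<and> (\<forall>n. M (s n) (G n) < \<epsilon> / 2) \<and>
          disjoint_family (\<lambda>n. T (s n) - G n)"
        by (intro gliding_hump) (use fin r(1) in \<open>auto simp: T_def\<close>)
      then obtain s G where s: "strict_mono (s :: nat \<Rightarrow> nat)" "\<forall>n. M (s n) (G n) < \<epsilon> / 2"
        "disjoint_family (\<lambda>n. T (s n) - G n)"
        by (elim exE conjE)
      \<comment> \<open>The humps of even and of odd index have disjoint unions, so \<open>x\<close> omits one of them.\<close>
      define Q where "Q b = {i. \<exists>n. even n = b \<and> principal {i} \<in> T (s n) - G n}" for b
      have "Q True \<inter> Q False = {}"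
      proof (rule ccontr)
        assume "Q True \<inter> Q False \<noteq> {}"
        then obtain i m n where "even m" "odd n"
          and K: "principal {i} \<in> T (s m) - G m" "principal {i} \<in> T (s n) - G n"
          unfolding Q_def by fast
        then have "m \<noteq> n" by blast
        then show False using s(3) K unfolding disjoint_family_on_def by blast
      qed
      then obtain b where b: "\<not> Q b \<in>\<^sub>F x"
        using ultrafilter_disjoint[of x "Q True" "Q False"] 2 weak_P_pointD omega_starD by blast
      \<comment> \<open>At an index \<open>n\<close> of parity \<open>b\<close> the set
        \<open>B'\<close> omits the whole hump. Besides \<open>x\<close> only points of
        \<open>G n\<close> remain, with mass below \<open>\<epsilon> / 2\<close>, so the coefficient
        of \<open>x\<close> cannot be cancelled.\<close>
      define B' where "B' = B \<inter> - Q b"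
      have B': "B' \<in>\<^sub>F x"
        using b B(1) ultrafilter_Compl 2 weak_P_pointD omega_starD
        unfolding B'_def by (blast intro: ultrafilter_Int)
      define g where "g n = (\<Sum>y\<in>S n. \<nu> n y * of_bool (B' \<in>\<^sub>F y))" for n
      have "\<epsilon> / 2 \<le> \<bar>g (r (s n))\<bar>" if n: "even n = b" for n
      proof -
        let ?N = "r (s n)"
        have G: "y \<in> T (s n) \<inter> G n" if y: "y \<in> S ?N - {x}" "B' \<in>\<^sub>F y" for y
        proof -
          have "B \<in>\<^sub>F y" using y(2) by (rule ultrafilter_mono) (simp add: B'_def)
          then have "y \<in> omega_points" "y \<in> T (s n)"
            using B_points y(1) by (auto simp: T_def)
          moreover obtain i where i: "y = principal {i}"
            using \<open>y \<in> omega_points\<close> by (auto simp: omega_points_def)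
          moreover have "i \<notin> Q b" using y(2) i by (auto simp: B'_def eventually_principal)
          ultimately show ?thesis using n by (auto simp: Q_def)
        qed
        have "g ?N = \<nu> ?N x + (\<Sum>y\<in>S ?N - {x}. \<nu> ?N y * of_bool (B' \<in>\<^sub>F y))"
          unfolding g_def using fin xS B' by (subst sum.remove[of _ x]) auto
        moreover have "\<bar>\<Sum>y\<in>S ?N - {x}. \<nu> ?N y * of_bool (B' \<in>\<^sub>F y)\<bar> \<le> M (s n) (G n)"
        proof -
          have "\<bar>\<Sum>y\<in>S ?N - {x}. \<nu> ?N y * of_bool (B' \<in>\<^sub>F y)\<bar>
              \<le> (\<Sum>y\<in>S ?N - {x}. \<bar>\<nu> ?N y\<bar> * of_bool (B' \<in>\<^sub>F y))"
            by (rule order_trans[OF sum_abs]) (simp add: abs_mult)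
          also have "\<dots> = (\<Sum>y\<in>{y\<in>S ?N - {x}. B' \<in>\<^sub>F y}. \<bar>\<nu> ?N y\<bar>)"
            using fin by (intro sum.mono_neutral_cong_right) auto
          also have "\<dots> \<le> M (s n) (G n)"
            unfolding M_def using G fin by (intro sum_mono2) (auto simp: T_def)
          finally show ?thesis .
        qed
        ultimately show ?thesis using s(2)[rule_format, of n] r(3)[of "s n"] by linarith
      qed
      moreover have "infinite {n :: nat. even n = b}"
        unfolding infinite_nat_iff_unbounded_le
      proof
        fix m :: nat
        show "\<exists>n\<ge>m. n \<in> {n. even n = b}"
          by (rule exI[of _ "2 * m + of_bool (\<not> b)"]) auto
      qed
      moreover have "strict_mono (\<lambda>n. r (s n))" using r(2) s(1) by (simp add: strict_mono_def)
      moreover have "g \<longlonglongrightarrow> 0" unfolding g_def by (rule conv)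
      ultimately show False
        using tendsto_zero_infinite_contradiction[of g "\<lambda>n. r (s n)" "{n. even n = b}" "\<epsilon> / 2"] r(1)
        by auto
    qed
  qed (rule point)
qed

text \<open>This is the Schur property: convergence against clopen indicators forces convergence in
  norm. Pointwise convergence provides the gliding hump, and disjoint neighbourhoods of the hump
  points allow two clopen sets to reproduce the signs of all coefficients on all humps at
  once.\<close>

lemma null_measures_norm:
  fixes \<nu> :: "nat \<Rightarrow> nat filter \<Rightarrow> real"
  assumes fin: "\<And>n. finite (S n)"
    and pts: "\<And>n x. x \<in> S n \<Longrightarrow> x \<in> omega_points \<or> weak_P_point x"
    and zero: "\<And>n x. x \<notin> S n \<Longrightarrow> \<nu> n x = 0"
    and conv: "\<And>B. (\<lambda>n. \<Sum>x\<in>S n. \<nu> n x * of_bool (B \<in>\<^sub>F x)) \<longlonglongrightarrow> 0"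
  shows "(\<lambda>n. \<Sum>x\<in>S n. \<bar>\<nu> n x\<bar>) \<longlonglongrightarrow> 0"
proof (rule ccontr)
  have beta: "y \<in> beta_omega" if "y \<in> S n" for y n
    using pts[OF that] omega_points_subset_beta_omega weak_P_pointD omega_starD by blast
  assume "\<not> ?thesis"
  then obtain \<epsilon> r where r: "\<epsilon> > 0" "strict_mono (r :: nat \<Rightarrow> nat)"
    "\<And>n. \<epsilon> \<le> \<bar>\<Sum>x\<in>S (r n). \<bar>\<nu> (r n) x\<bar>\<bar>"
    by (rule not_tendsto_zeroE) blast
  have r3: "\<epsilon> \<le> (\<Sum>x\<in>S (r n). \<bar>\<nu> (r n) x\<bar>)" for n
    using r(3)[of n] by (simp add: sum_nonneg)
  define M where "M n F = (\<Sum>y\<in>S (r n) \<inter> F. \<bar>\<nu> (r n) y\<bar>)" for n F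
  have M_null: "(\<lambda>n. M n F) \<longlonglongrightarrow> 0" if "finite F" for F
  proof -
    have "M n F = (\<Sum>y\<in>F. \<bar>\<nu> (r n) y\<bar>)" for n
      unfolding M_def using that zero by (intro sum.mono_neutral_left) auto
    moreover have "(\<lambda>n. \<nu> (r n) y) \<longlonglongrightarrow> 0" for y
      using LIMSEQ_subseq_LIMSEQ[OF null_measures_pointwise[OF assms] r(2)] by (simp add: o_def)
    ultimately show ?thesis by (auto intro!: tendsto_null_sum tendsto_rabs_zero)
  qed
  have \<epsilon>: "\<epsilon> / 4 > 0" using r(1) by simp
  have "\<exists>s G U. strict_mono (s :: nat \<Rightarrow> nat) \<and> (\<forall>n. M (s n) (G n) < \<epsilon> / 4) \<and>
      disjoint_family (\<lambda>n. S (r (s n)) - G n) \<and> (\<forall>n. \<forall>x\<in>S (r (s n)) - G n. U x \<in>\<^sub>F x) \<and>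
      (\<forall>x\<in>(\<Union>n. S (r (s n)) - G n). \<forall>y\<in>(\<Union>n. S (r (s n)) - G n). x \<noteq> y \<longrightarrow> U x \<inter> U y = {})"
    by (rule gliding_hump_disjoint_neighbourhoods) (fact fin M_null \<epsilon> pts | use pts in blast)+
  then obtain s G U where s: "strict_mono (s :: nat \<Rightarrow> nat)" "\<forall>n. M (s n) (G n) < \<epsilon> / 4"
    "disjoint_family (\<lambda>n. S (r (s n)) - G n)"
    and U': "\<forall>n. \<forall>x\<in>S (r (s n)) - G n. U x \<in>\<^sub>F x"
      "\<forall>x\<in>(\<Union>n. S (r (s n)) - G n). \<forall>y\<in>(\<Union>n. S (r (s n)) - G n). x \<noteq> y \<longrightarrow> U x \<inter> U y = {}"
    by (elim exE conjE)
  have U: "\<And>n x. x \<in> S (r (s n)) - G n \<Longrightarrow> U x \<in>\<^sub>F x"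
    "\<And>m n x y. x \<in> S (r (s m)) - G m \<Longrightarrow> y \<in> S (r (s n)) - G n \<Longrightarrow> x \<noteq> y \<Longrightarrow> U x \<inter> U y = {}"
    using U' by blast+
  define K where "K n = S (r (s n)) - G n" for n
  \<comment> \<open>Used for \<open>c = 1\<close> and \<open>c = -1\<close>: on every hump, the
    difference of the two indicators is the sign of the coefficient.\<close>
  define B where "B c = (\<Union>n. \<Union>x\<in>{x\<in>K n. c * \<nu> (r (s n)) x > 0}. U x)" for c :: real
  have B: "B c \<in>\<^sub>F x \<longleftrightarrow> c * \<nu> (r (s n)) x > 0" if x: "x \<in> K n" for x n c
  proof
    assume "c * \<nu> (r (s n)) x > 0"
    then show "B c \<in>\<^sub>F x"
      by (intro ultrafilter_mono[OF U(1)]) (use x in \<open>auto simp: B_def K_def\<close>)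
  next
    assume "B c \<in>\<^sub>F x"
    then obtain m y where m: "y \<in> K m" "c * \<nu> (r (s m)) y > 0" "U y \<inter> U x \<noteq> {}"
      using ultrafilter_disjoint[OF beta, of x "r (s n)" "B c" "U x"] U(1)[of x n] x
      by (auto simp: B_def K_def)
    then have "y = x" using U(2) x unfolding K_def by blast
    moreover have "m = n"
      using s(3) m(1) x \<open>y = x\<close> unfolding disjoint_family_on_def K_def by blast
    ultimately show "c * \<nu> (r (s n)) x > 0" using m(2) by simp
  qed
  define g where "g n = (\<Sum>x\<in>S n. \<nu> n x * of_bool (B 1 \<in>\<^sub>F x)) -
    (\<Sum>x\<in>S n. \<nu> n x * of_bool (B (-1) \<in>\<^sub>F x))" for n
  have "g \<longlonglongrightarrow> 0"
    unfolding g_def using tendsto_diff[OF conv[of "B 1"] conv[of "B (-1)"]] by simp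
  \<comment> \<open>The hump carries at least \<open>\<epsilon> - \<epsilon> / 4\<close>, and the
    points of \<open>G n\<close> disturb the integral by less than
    \<open>\<epsilon> / 4\<close>.\<close>
  moreover have "\<epsilon> / 2 \<le> \<bar>g (r (s n))\<bar>" for n
  proof -
    let ?N = "r (s n)"
    let ?h = "\<lambda>x. \<nu> ?N x * (of_bool (B 1 \<in>\<^sub>F x) - of_bool (B (-1) \<in>\<^sub>F x))"
    have split: "sum h (S ?N) = sum h (K n) + sum h (S ?N \<inter> G n)" for h :: "_ \<Rightarrow> real"
      unfolding K_def using fin by (subst sum.Int_Diff[of _ _ "G n"]) auto
    have "g ?N = sum ?h (S ?N)"
      unfolding g_def by (simp add: sum_subtractf right_diff_distrib)
    also have "\<dots> = (\<Sum>x\<in>K n. \<bar>\<nu> ?N x\<bar>) + sum ?h (S ?N \<inter> G n)"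
      unfolding split by (simp add: B cong: sum.cong) (auto intro!: sum.cong)
    finally have "g ?N = (\<Sum>x\<in>K n. \<bar>\<nu> ?N x\<bar>) + sum ?h (S ?N \<inter> G n)" .
    moreover have "\<bar>sum ?h (S ?N \<inter> G n)\<bar> \<le> M (s n) (G n)"
      unfolding M_def by (rule order_trans[OF sum_abs]) (intro sum_mono, simp add: abs_mult)
    moreover have "\<epsilon> \<le> (\<Sum>x\<in>K n. \<bar>\<nu> ?N x\<bar>) + M (s n) (G n)"
      using r3[of "s n"] unfolding split M_def .
    ultimately show ?thesis using s(2)[rule_format, of n] by linarith
  qed
  moreover have "strict_mono (\<lambda>n. r (s n))" using r(2) s(1) by (simp add: strict_mono_def)
  ultimately show False
    using tendsto_zero_infinite_contradiction[of g "\<lambda>n. r (s n)" UNIV "\<epsilon> / 2"] r(1) by auto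
qed

section \<open>Estimates for finite sums and large directed cuts\<close>

lemma sum_abs_Un_le:
  fixes h :: "'a \<Rightarrow> real"
  assumes "finite A" "finite B"
  shows "(\<Sum>z\<in>A \<union> B. \<bar>h z\<bar>) \<le> (\<Sum>z\<in>A. \<bar>h z\<bar>) + (\<Sum>z\<in>B. \<bar>h z\<bar>)"
proof -
  have "0 \<le> (\<Sum>z\<in>A \<inter> B. \<bar>h z\<bar>)" by (simp add: sum_nonneg)
  with sum.union_inter[OF assms, of "\<lambda>z. \<bar>h z\<bar>"] show ?thesis by linarith
qed

text \<open>A greedy cut captures at least half of the symmetrized weight: each new vertex joins the
  side from which its weight across the cut is larger. Orienting the cut in the better of its two
  directions costs another factor 2, whence the constant 4.\<close>

lemma ex_large_cut:
  fixes w :: "'a \<Rightarrow> 'a \<Rightarrow> real"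
  assumes "finite K"
  shows "\<exists>L\<subseteq>K. (\<Sum>x\<in>K. \<Sum>y\<in>K - {x}. w x y) \<le> 4 * (\<Sum>x\<in>L. \<Sum>y\<in>K - L. w x y)"
proof -
  have "\<exists>L\<subseteq>K. (\<Sum>x\<in>K. \<Sum>y\<in>K - {x}. w x y) \<le> 2 * (\<Sum>x\<in>L. \<Sum>y\<in>K - L. w x y + w y x)"
    using assms
  proof induction
    case (insert a K)
    then obtain L where L: "L \<subseteq> K"
      "(\<Sum>x\<in>K. \<Sum>y\<in>K - {x}. w x y) \<le> 2 * (\<Sum>x\<in>L. \<Sum>y\<in>K - L. w x y + w y x)" by blast
    have fin: "finite L" "finite (K - L)" "a \<notin> L" "a \<notin> K - L"
      using L insert finite_subset by auto
    have "(\<Sum>x\<in>insert a K. \<Sum>y\<in>insert a K - {x}. w x y)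
        = (\<Sum>y\<in>K. w a y) + (\<Sum>x\<in>K. w x a + (\<Sum>y\<in>K - {x}. w x y))"
    proof -
      have "insert a K - {a} = K" using insert by auto
      moreover have "(\<Sum>y\<in>insert a K - {x}. w x y) = w x a + (\<Sum>y\<in>K - {x}. w x y)" if "x \<in> K" for x
      proof -
        have "insert a K - {x} = insert a (K - {x})" using insert that by auto
        then show ?thesis using insert by simp
      qed
      ultimately show ?thesis using insert by simp
    qed
    also have "\<dots> = (\<Sum>y\<in>K. w a y + w y a) + (\<Sum>x\<in>K. \<Sum>y\<in>K - {x}. w x y)"
      by (simp add: sum.distrib)
    also have "(\<Sum>y\<in>K. w a y + w y a) = (\<Sum>y\<in>L. w a y + w y a) + (\<Sum>y\<in>K - L. w a y + w y a)"
      using L(1) insert(1) by (metis add.commute sum.subset_diff)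
    finally have total: "(\<Sum>x\<in>insert a K. \<Sum>y\<in>insert a K - {x}. w x y) =
      (\<Sum>y\<in>L. w a y + w y a) + (\<Sum>y\<in>K - L. w a y + w y a) + (\<Sum>x\<in>K. \<Sum>y\<in>K - {x}. w x y)" .
    have "insert a K - L = insert a (K - L)" using fin by auto
    then have 1: "(\<Sum>x\<in>L. \<Sum>y\<in>insert a K - L. w x y + w y x) =
        (\<Sum>y\<in>L. w a y + w y a) + (\<Sum>x\<in>L. \<Sum>y\<in>K - L. w x y + w y x)"
      using fin by (simp add: sum.distrib)
    have "insert a K - insert a L = K - L" using insert by auto
    then have 2: "(\<Sum>x\<in>insert a L. \<Sum>y\<in>insert a K - insert a L. w x y + w y x) =
        (\<Sum>y\<in>K - L. w a y + w y a) + (\<Sum>x\<in>L. \<Sum>y\<in>K - L. w x y + w y x)"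
      using fin by simp
    show ?case
    proof (cases "(\<Sum>y\<in>L. w a y + w y a) \<le> (\<Sum>y\<in>K - L. w a y + w y a)")
      case True
      with total 2 L show ?thesis by (intro exI[of _ "insert a L"]) auto
    next
      case False
      with total 1 L show ?thesis by (intro exI[of _ L]) auto
    qed
  qed simp
  then obtain L where L: "L \<subseteq> K"
    "(\<Sum>x\<in>K. \<Sum>y\<in>K - {x}. w x y) \<le> 2 * (\<Sum>x\<in>L. \<Sum>y\<in>K - L. w x y + w y x)" by blast
  \<comment> \<open>The symmetrized cut splits into the directed cuts of \<open>L\<close> and of
    \<open>K - L\<close>; the witness is whichever set has the larger one.\<close>
  have "(\<Sum>x\<in>L. \<Sum>y\<in>K - L. w x y + w y x) =
      (\<Sum>x\<in>L. \<Sum>y\<in>K - L. w x y) + (\<Sum>x\<in>K - L. \<Sum>y\<in>L. w x y)"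
    using sum.swap[of "\<lambda>x y. w y x" "K - L" L] by (simp add: sum.distrib)
  moreover have "K - (K - L) = L" using L(1) by blast
  ultimately show ?thesis
    using L by (cases "(\<Sum>x\<in>L. \<Sum>y\<in>K - L. w x y) \<le> (\<Sum>x\<in>K - L. \<Sum>y\<in>L. w x y)")
      (auto intro: exI[of _ L] exI[of _ "K - L"])
qed

section \<open>The square\<close>

definition locally_constant_on :: "nat filter set \<Rightarrow> (nat filter \<times> nat filter \<Rightarrow> real) \<Rightarrow> bool" where
  "locally_constant_on Y F \<longleftrightarrow> (\<forall>x\<in>Y. \<forall>y\<in>Y. \<exists>A B. A \<in>\<^sub>F x \<and> B \<in>\<^sub>F y \<and>
     (\<forall>x'\<in>Y. \<forall>y'\<in>Y. A \<in>\<^sub>F x' \<longrightarrow> B \<in>\<^sub>F y' \<longrightarrow> F (x', y') = F (x, y)))"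

lemma locally_constant_on_imp_continuous_map:
  assumes Y: "Y \<subseteq> beta_omega" and F: "locally_constant_on Y F"
    and X: "X = subtopology beta_omega_topology Y"
  shows "continuous_map (prod_topology X X) euclideanreal F"
proof -
  have top: "topspace X = Y" using Y X by auto
  have open_nbhd: "openin X {x \<in> Y. A \<in>\<^sub>F x}" for A
    unfolding X openin_subtopology using Y openin_beta_omega_basic[of A] by blast
  \<comment> \<open>Here \<open>V\<close> is an arbitrary set of reals: local constancy makes every
    preimage open.\<close>
  have "openin (prod_topology X X) {z \<in> Y \<times> Y. F z \<in> V}" for V
  proof (subst openin_subopen, intro ballI)
    fix z assume "z \<in> {z \<in> Y \<times> Y. F z \<in> V}"
    then obtain x y where z: "z = (x, y)" "x \<in> Y" "y \<in> Y" "F (x, y) \<in> V" by auto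
    then obtain A B where AB: "A \<in>\<^sub>F x" "B \<in>\<^sub>F y"
      "\<forall>x'\<in>Y. \<forall>y'\<in>Y. A \<in>\<^sub>F x' \<longrightarrow> B \<in>\<^sub>F y' \<longrightarrow> F (x', y') = F (x, y)"
      using F unfolding locally_constant_on_def by blast
    show "\<exists>T. openin (prod_topology X X) T \<and> z \<in> T \<and> T \<subseteq> {z \<in> Y \<times> Y. F z \<in> V}"
    proof (intro exI conjI)
      show "openin (prod_topology X X) ({x \<in> Y. A \<in>\<^sub>F x} \<times> {y \<in> Y. B \<in>\<^sub>F y})"
        using open_nbhd by (simp add: openin_prod_Times_iff)
      have "F (x', y') \<in> V" if "x' \<in> Y" "y' \<in> Y" "A \<in>\<^sub>F x'" "B \<in>\<^sub>F y'" for x' y'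
        using AB(3)[rule_format, OF that] z(4) by simp
      then show "{x \<in> Y. A \<in>\<^sub>F x} \<times> {y \<in> Y. B \<in>\<^sub>F y} \<subseteq> {z \<in> Y \<times> Y. F z \<in> V}" by blast
    qed (use z(1-3) AB(1,2) in auto)
  qed
  then show ?thesis by (simp add: continuous_map_def top)
qed

lemma locally_constant_on_rectangle:
  assumes "Y \<subseteq> beta_omega"
  shows "locally_constant_on Y (\<lambda>z. of_bool (A \<in>\<^sub>F fst z \<and> B \<in>\<^sub>F snd z))"
proof -
  have dec: "\<exists>D. D \<in>\<^sub>F x \<and> (\<forall>x'\<in>Y. D \<in>\<^sub>F x' \<longrightarrow> (C \<in>\<^sub>F x' \<longleftrightarrow> C \<in>\<^sub>F x))" if "x \<in> Y" for x C
  proof (cases "C \<in>\<^sub>F x")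
    case False
    then show ?thesis
      using that assms ultrafilter_Compl by (intro exI[of _ "- C"]) blast
  qed blast
  show ?thesis
    unfolding locally_constant_on_def
  proof (intro ballI)
    fix x y assume "x \<in> Y" "y \<in> Y"
    obtain D where "D \<in>\<^sub>F x" "\<forall>x'\<in>Y. D \<in>\<^sub>F x' \<longrightarrow> (A \<in>\<^sub>F x' \<longleftrightarrow> A \<in>\<^sub>F x)"
      using dec[OF \<open>x \<in> Y\<close>] by blast
    moreover obtain E where "E \<in>\<^sub>F y" "\<forall>y'\<in>Y. E \<in>\<^sub>F y' \<longrightarrow> (B \<in>\<^sub>F y' \<longleftrightarrow> B \<in>\<^sub>F y)"
      using dec[OF \<open>y \<in> Y\<close>] by blast
    ultimately show "\<exists>D E. D \<in>\<^sub>F x \<and> E \<in>\<^sub>F y \<and> (\<forall>x'\<in>Y. \<forall>y'\<in>Y. D \<in>\<^sub>F x' \<longrightarrow> E \<in>\<^sub>F y' \<longrightarrow>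
        of_bool (A \<in>\<^sub>F fst (x', y') \<and> B \<in>\<^sub>F snd (x', y')) =
        (of_bool (A \<in>\<^sub>F fst (x, y) \<and> B \<in>\<^sub>F snd (x, y)) :: real))"
      by (intro exI[of _ D] exI[of _ E]) auto
  qed
qed

text \<open>Two applications of the one-dimensional results. For fixed \<open>B\<close>, the
  projection to the first factor of the measure restricted to second coordinates in \<open>B\<close>
  is null against clopen sets, by testing on rectangles; its coefficient at \<open>a\<close>
  therefore tends to 0. As \<open>B\<close> varies, this is the hypothesis of the Schur property for
  the slice at \<open>a\<close>.\<close>

lemma null_measures_slice:
  fixes \<mu> :: "nat \<Rightarrow> nat filter \<times> nat filter \<Rightarrow> real"
  assumes fin: "\<And>n. finite (S n)"
    and pts: "\<And>n x y. (x, y) \<in> S n \<Longrightarrow> (x \<in> omega_points \<or> weak_P_point x) \<and> (y \<in> omega_points \<or> weak_P_point y)"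
    and zero: "\<And>n z. z \<notin> S n \<Longrightarrow> \<mu> n z = 0"
    and conv: "\<And>A B. (\<lambda>n. \<Sum>z\<in>S n. \<mu> n z * of_bool (A \<in>\<^sub>F fst z \<and> B \<in>\<^sub>F snd z)) \<longlonglongrightarrow> 0"
  shows "(\<lambda>n. \<Sum>y\<in>snd ` S n. \<bar>\<mu> n (a, y)\<bar>) \<longlonglongrightarrow> 0"
proof (rule null_measures_norm)
  have pts': "x \<in> omega_points \<or> weak_P_point x" if "x \<in> fst ` S n \<union> snd ` S n" for x n
    using that pts by fastforce
  show "finite (snd ` S n)" "\<And>x. x \<in> snd ` S n \<Longrightarrow> x \<in> omega_points \<or> weak_P_point x" for n
    using fin pts' by blast+
  fix B
  show "(\<lambda>n. \<Sum>y\<in>snd ` S n. \<mu> n (a, y) * of_bool (B \<in>\<^sub>F y)) \<longlonglongrightarrow> 0"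
  proof (rule null_measures_pointwise[where S = "\<lambda>n. fst ` S n" and x = a])
    fix A
    have "(\<Sum>x\<in>fst ` S n. (\<Sum>y\<in>snd ` S n. \<mu> n (x, y) * of_bool (B \<in>\<^sub>F y)) * of_bool (A \<in>\<^sub>F x))
      = (\<Sum>z\<in>S n. \<mu> n z * of_bool (A \<in>\<^sub>F fst z \<and> B \<in>\<^sub>F snd z))" for n
    proof -
      have "(\<Sum>x\<in>fst ` S n. (\<Sum>y\<in>snd ` S n. \<mu> n (x, y) * of_bool (B \<in>\<^sub>F y)) * of_bool (A \<in>\<^sub>F x))
        = (\<Sum>z\<in>fst ` S n \<times> snd ` S n. \<mu> n z * of_bool (A \<in>\<^sub>F fst z \<and> B \<in>\<^sub>F snd z))"
        unfolding sum_distrib_right sum.cartesian_product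
        by (intro sum.cong) (auto simp: of_bool_conj)
      also have "\<dots> = (\<Sum>z\<in>S n. \<mu> n z * of_bool (A \<in>\<^sub>F fst z \<and> B \<in>\<^sub>F snd z))"
        using fin zero by (intro sum.mono_neutral_right) (auto intro: rev_image_eqI)
      finally show ?thesis .
    qed
    then show "(\<lambda>n. \<Sum>x\<in>fst ` S n. (\<Sum>y\<in>snd ` S n. \<mu> n (x, y) * of_bool (B \<in>\<^sub>F y)) * of_bool (A \<in>\<^sub>F x)) \<longlonglongrightarrow> 0"
      using conv by simp
  next
    fix n x assume "x \<notin> fst ` S n"
    then have "\<mu> n (x, y) = 0" for y using zero by (metis fst_conv image_eqI)
    then show "(\<Sum>y\<in>snd ` S n. \<mu> n (x, y) * of_bool (B \<in>\<^sub>F y)) = 0" by simp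
  next
    show "finite (fst ` S n)" "\<And>x. x \<in> fst ` S n \<Longrightarrow> x \<in> omega_points \<or> weak_P_point x" for n
      using fin pts' by blast+
  qed
next
  fix n y assume "y \<notin> snd ` S n"
  then show "\<mu> n (a, y) = 0" using zero by (metis snd_conv image_eqI)
qed

text \<open>
  Restricting to the rectangles \<open>L n \<times> (K n - L n)\<close> gives continuity at the diagonal points
  \<open>(u A, u A)\<close>, about which the incomparability hypothesis says nothing.
\<close>

lemma off_diagonal_function:
  fixes u :: "nat set \<Rightarrow> nat filter" and \<sigma> :: "nat filter \<times> nat filter \<Rightarrow> real"
    and K L :: "nat \<Rightarrow> nat filter set" and U :: "nat filter \<Rightarrow> nat set"
  assumes weak: "\<And>A. A \<in> infinite_subsets \<Longrightarrow> weak_P_point (u A)"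
    and incomparable: "\<And>f1 f2 :: nat \<Rightarrow> nat.
           \<exists>\<A>. \<A> \<subseteq> infinite_subsets \<and> \<A> \<prec> (UNIV :: nat set set) \<and>
             (\<forall>A1 \<in> infinite_subsets - \<A>. \<forall>A2 \<in> infinite_subsets - {A1}.
                filtermap f1 (u A1) \<in> omega_star \<and> filtermap f2 (u A2) \<in> omega_star \<longrightarrow>
                filtermap f1 (u A1) \<noteq> filtermap f2 (u A2))"
    and Y: "Y = omega_points \<union> u ` infinite_subsets"
    and K: "\<And>n. finite (K n)" "disjoint_family K" "\<And>n. K n \<subseteq> Y"
    and U: "\<And>n x. x \<in> K n \<Longrightarrow> U x \<in>\<^sub>F x"
      "\<And>m n x y. x \<in> K m \<Longrightarrow> y \<in> K n \<Longrightarrow> x \<noteq> y \<Longrightarrow> U x \<inter> U y = {}"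
    and L: "\<And>n. L n \<subseteq> K n"
    and \<sigma>: "\<And>z. \<bar>\<sigma> z\<bar> \<le> 1"
  shows "\<exists>I F. infinite I \<and> locally_constant_on Y F \<and> (\<forall>x\<in>Y. \<forall>y\<in>Y. \<bar>F (x, y)\<bar> \<le> 1) \<and>
    (\<forall>n\<in>I. \<forall>x\<in>K n. \<forall>y\<in>K n. F (x, y) = (if x \<in> L n \<and> y \<notin> L n then \<sigma> (x, y) else 0))"
proof -
  have beta: "x \<in> beta_omega" if "x \<in> Y" for x
    using that Y weak weak_P_pointD omega_starD omega_points_subset_beta_omega by blast
  have K_unique: "m = n" if "x \<in> K m" "x \<in> K n" for x m n
    using that K(2) unfolding disjoint_family_on_def by blast
  \<comment> \<open>The map collapses the neighbourhood of \<open>K n\<close> to \<open>n\<close>.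
    Elsewhere its value is unspecified, so the arguments below intersect its fibres and preimages
    with the neighbourhoods before evaluating it.\<close>
  define f where "f i = (THE n. \<exists>a\<in>K n. i \<in> U a)" for i
  have f: "f i = n" if "a \<in> K n" "i \<in> U a" for i a n
    unfolding f_def
  proof (rule the_equality)
    fix m assume "\<exists>b\<in>K m. i \<in> U b"
    then obtain b where "b \<in> K m" "i \<in> U b" by blast
    then show "m = n" using U(2)[of a n b m] that K_unique by blast
  qed (use that in blast)
  obtain \<A> where \<A>: "\<A> \<prec> (UNIV :: nat set set)"
    "\<And>A1 A2. A1 \<in> infinite_subsets - \<A> \<Longrightarrow> A2 \<in> infinite_subsets - {A1} \<Longrightarrow>
       filtermap f (u A1) \<in> omega_star \<Longrightarrow> filtermap f (u A2) \<in> omega_star \<Longrightarrow>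
       filtermap f (u A1) \<noteq> filtermap f (u A2)"
    using incomparable[of f f] by blast
  \<comment> \<open>The exceptional indices are made harmless: restricted to humps with index in
    \<open>I\<close>, no free image of an exceptional point under \<open>f\<close> is concentrated
    on these indices.\<close>
  have "\<exists>I. infinite I \<and> (\<forall>A\<in>\<A>. \<not> (filtermap f (u A) \<in> omega_star \<and> I \<in>\<^sub>F filtermap f (u A)))"
  proof (rule ex_infinite_avoiding[OF \<A>(1)])
    fix A S T
    assume "filtermap f (u A) \<in> omega_star \<and> S \<in>\<^sub>F filtermap f (u A)"
      "filtermap f (u A) \<in> omega_star \<and> T \<in>\<^sub>F filtermap f (u A)"
    then show "infinite (S \<inter> T)"
      using omega_star_finite ultrafilter_Int by blast
  qed
  then obtain I where I: "infinite I"
    "\<And>A. A \<in> \<A> \<Longrightarrow> filtermap f (u A) \<in> omega_star \<Longrightarrow> \<not> I \<in>\<^sub>F filtermap f (u A)" by blast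
  \<comment> \<open>The pair of hump points whose rectangle contains \<open>(x, y)\<close>. By
    disjointness there is at most one when \<open>x\<close> and \<open>y\<close> lie in
    \<open>Y\<close>, so the sum defining \<open>F\<close> is either empty or a single value of
    \<sigma>.\<close>
  define C where "C x y = {(a, b). U a \<in>\<^sub>F x \<and> U b \<in>\<^sub>F y \<and> (\<exists>n\<in>I. a \<in> L n \<and> b \<in> K n - L n)}" for x y
  define F where "F z = sum \<sigma> (C (fst z) (snd z))" for z
  have unique: "a = b" if "x \<in> Y" "U a \<in>\<^sub>F x" "U b \<in>\<^sub>F x" "a \<in> K m" "b \<in> K n" for x a b m n
    using ultrafilter_disjoint[OF beta that(2,3)] U(2) that by blast
  have LK: "a \<in> K n" if "a \<in> L n" for a n using L that by blast
  have C_at: "C x y = (if \<exists>n\<in>I. a \<in> L n \<and> b \<in> K n - L n then {(a, b)} else {})"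
    if "x \<in> Y" "y \<in> Y" "U a \<in>\<^sub>F x" "U b \<in>\<^sub>F y" "a \<in> K m" "b \<in> K n" for x y a b m n
  proof -
    have ab: "c = a" if "U c \<in>\<^sub>F x" "c \<in> K k" for c k
      using unique[OF \<open>x \<in> Y\<close> that(1) \<open>U a \<in>\<^sub>F x\<close> that(2) \<open>a \<in> K m\<close>] .
    have bb: "c = b" if "U c \<in>\<^sub>F y" "c \<in> K k" for c k
      using unique[OF \<open>y \<in> Y\<close> that(1) \<open>U b \<in>\<^sub>F y\<close> that(2) \<open>b \<in> K n\<close>] .
    have "(c, d) \<in> C x y \<longleftrightarrow> (\<exists>n\<in>I. a \<in> L n \<and> b \<in> K n - L n) \<and> c = a \<and> d = b" for c d
    proof
      assume "(c, d) \<in> C x y"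
      then obtain k where k: "U c \<in>\<^sub>F x" "U d \<in>\<^sub>F y" "k \<in> I" "c \<in> L k" "d \<in> K k - L k"
        unfolding C_def by blast
      have "c = a" "d = b" using ab[OF k(1) LK[OF k(4)]] bb[OF k(2)] k(5) by auto
      then show "(\<exists>n\<in>I. a \<in> L n \<and> b \<in> K n - L n) \<and> c = a \<and> d = b" using k by blast
    qed (use that(3,4) in \<open>auto simp: C_def\<close>)
    then show ?thesis by auto
  qed
  have "locally_constant_on Y F"
    unfolding locally_constant_on_def
  proof (intro ballI)
    fix x y assume xy: "x \<in> Y" "y \<in> Y"
    define G where "G n = (\<Union>a\<in>K n. U a)" for n
    define G0 where "G0 = (\<Union>n\<in>I. \<Union>a\<in>L n. U a)"
    define G1 where "G1 = (\<Union>n\<in>I. \<Union>a\<in>K n - L n. U a)"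
    have G_not: "\<not> U a \<in>\<^sub>F x'" if "- G n \<in>\<^sub>F x'" "x' \<in> Y" "a \<in> K n" for x' a n
      using ultrafilter_disjoint[OF beta[OF that(2)] that(1)] that(3) by (auto simp: G_def)
    have G_in: "\<exists>a\<in>K n. U a \<in>\<^sub>F x'" if "\<not> - G n \<in>\<^sub>F x'" "x' \<in> Y" for x' n
      using ultrafilter_finite_UN[OF beta[OF that(2)] K(1)[of n], of U] that
        ultrafilter_Compl[OF beta[OF that(2)], of "G n"] by (auto simp: G_def)
    have "\<exists>A B. A \<in>\<^sub>F x \<and> B \<in>\<^sub>F y \<and>
        (\<forall>x'\<in>Y. \<forall>y'\<in>Y. A \<in>\<^sub>F x' \<longrightarrow> B \<in>\<^sub>F y' \<longrightarrow> C x' y' = C x y)"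
    proof -
      \<comment> \<open>In every case but the first one below, \<open>C\<close> is shown to be empty
        on a whole neighbourhood, which includes \<open>(x, y)\<close> itself.\<close>
      have emptyI: ?thesis if AB: "A \<in>\<^sub>F x" "B \<in>\<^sub>F y"
        "\<And>x' y'. x' \<in> Y \<Longrightarrow> y' \<in> Y \<Longrightarrow> A \<in>\<^sub>F x' \<Longrightarrow> B \<in>\<^sub>F y' \<Longrightarrow> C x' y' = {}" for A B
        using AB xy by (intro exI[of _ A] exI[of _ B]) auto
      consider (both) a m b n where "U a \<in>\<^sub>F x" "a \<in> K m" "U b \<in>\<^sub>F y" "b \<in> K n"
        | (left) a m where "U a \<in>\<^sub>F x" "a \<in> K m" "\<forall>n. - G n \<in>\<^sub>F y"
        | (right) b n where "U b \<in>\<^sub>F y" "b \<in> K n" "\<forall>n. - G n \<in>\<^sub>F x"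
        | (neither) "\<forall>n. - G n \<in>\<^sub>F x" "\<forall>n. - G n \<in>\<^sub>F y"
        using G_in xy by metis
      then show ?thesis
      proof cases
        case both
        then show ?thesis
          using C_at xy by (intro exI[of _ "U a"] exI[of _ "U b"]) auto
      next
        \<comment> \<open>Pairs in \<open>C\<close> have both entries in the same
          \<open>K n\<close>. If the first coordinate stays in \<open>U a\<close> with
          \<open>a\<close> in \<open>K m\<close>, the second one must meet the neighbourhood of
          \<open>K m\<close>, which \<open>- G m\<close> forbids.\<close>
        case left
        show ?thesis
        proof (rule emptyI[of "U a" "- G m"])
          fix x' y' assume "x' \<in> Y" "y' \<in> Y" "U a \<in>\<^sub>F x'" "- G m \<in>\<^sub>F y'"
          then show "C x' y' = {}"
            unfolding C_def using unique[OF \<open>x' \<in> Y\<close>] left(2) LK G_not K_unique by fast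
        qed (use left in auto)
      next
        case right
        show ?thesis
        proof (rule emptyI[of "- G n" "U b"])
          fix x' y' assume "x' \<in> Y" "y' \<in> Y" "- G n \<in>\<^sub>F x'" "U b \<in>\<^sub>F y'"
          then show "C x' y' = {}"
            unfolding C_def using unique[OF \<open>y' \<in> Y\<close>] right(2) LK G_not K_unique by fast
        qed (use right in auto)
      next
        case neither
        have C_G: "G0 \<in>\<^sub>F x' \<and> G1 \<in>\<^sub>F y'" if ne: "C x' y' \<noteq> {}" for x' y'
        proof -
          obtain a b n where "U a \<in>\<^sub>F x'" "U b \<in>\<^sub>F y'" "n \<in> I" "a \<in> L n" "b \<in> K n - L n"
            using ne unfolding C_def by blast
          then show ?thesis
            unfolding G0_def G1_def by (blast intro: ultrafilter_mono)
        qed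
        have not_both: "\<not> (A \<in>\<^sub>F x' \<and> - A \<in>\<^sub>F x')" if "x' \<in> Y" for x' A
          using ultrafilter_Compl[OF beta[OF that]] by blast
        have G_I: "I \<in>\<^sub>F filtermap f x'" if "(\<Union>n\<in>I. G n) \<in>\<^sub>F x'" for x'
          unfolding eventually_filtermap using that
          by (rule eventually_mono) (use f in \<open>auto simp: G_def\<close>)
        \<comment> \<open>On the union of the \<open>G n\<close>, the fibre of \<open>f\<close> over
          \<open>k\<close> lies in \<open>G k\<close>, which is not in \<open>x'\<close>. So no
          fibre belongs to \<open>x'\<close>, and neither \<open>x'\<close> nor its image is
          principal.\<close>
        have star: "filtermap f x' \<in> omega_star \<and> x' \<in> omega_star"
          if x': "x' \<in> Y" "\<forall>n. - G n \<in>\<^sub>F x'" "(\<Union>n\<in>I. G n) \<in>\<^sub>F x'" for x'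
        proof -
          have no_vimage: "\<not> {i. f i = k} \<in>\<^sub>F x'" for k
          proof
            assume "{i. f i = k} \<in>\<^sub>F x'"
            then have "G k \<in>\<^sub>F x'"
              by (rule ultrafilter_mono[OF ultrafilter_Int[OF _ x'(3)]])
                (use f in \<open>fastforce simp: G_def\<close>)
            then show False using not_both x'(1,2) by blast
          qed
          have "filtermap f x' \<notin> omega_points"
          proof
            assume "filtermap f x' \<in> omega_points"
            then obtain k where "filtermap f x' = principal {k}" by (auto simp: omega_points_def)
            then have "{k} \<in>\<^sub>F filtermap f x'" by (simp add: eventually_principal)
            then show False using no_vimage[of k] by (simp add: eventually_filtermap)
          qed
          moreover have "x' \<notin> omega_points"
          proof
            assume "x' \<in> omega_points"
            then obtain k where "x' = principal {k}" by (auto simp: omega_points_def)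
            then show False using no_vimage[of "f k"] by (simp add: eventually_principal)
          qed
          ultimately show ?thesis
            using filtermap_beta_omega[OF beta[OF x'(1)]] beta[OF x'(1)]
            by (simp add: omega_star_def)
        qed
        show ?thesis
        proof (cases "G0 \<in>\<^sub>F x \<and> G1 \<in>\<^sub>F y")
          case False
          then consider "- G0 \<in>\<^sub>F x" | "- G1 \<in>\<^sub>F y"
            using ultrafilter_Compl[OF beta[OF xy(1)]] ultrafilter_Compl[OF beta[OF xy(2)]] by blast
          then show ?thesis
          proof cases
            case 1
            show ?thesis
              by (rule emptyI[of "- G0" UNIV]) (use 1 C_G not_both in auto)
          next
            case 2
            show ?thesis
              by (rule emptyI[of UNIV "- G1"]) (use 2 C_G not_both in auto)
          qed
        next
          case True
          then have G: "(\<Union>n\<in>I. G n) \<in>\<^sub>F x" "(\<Union>n\<in>I. G n) \<in>\<^sub>F y"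
            using LK by (auto simp: G0_def G1_def G_def elim!: eventually_mono)
          have star_x: "filtermap f x \<in> omega_star" "x \<in> omega_star"
            and star_y: "filtermap f y \<in> omega_star" "y \<in> omega_star"
            using star xy neither G by blast+
          obtain A1 A2 where A: "A1 \<in> infinite_subsets" "x = u A1" "A2 \<in> infinite_subsets" "y = u A2"
            using star_x(2) star_y(2) xy Y by (auto simp: omega_star_def)
          \<comment> \<open>The cut enters here: \<open>G0\<close> and \<open>G1\<close> are
            disjoint because \<open>L n\<close> and \<open>K n - L n\<close> are, so no single
            ultrafilter contains both.\<close>
          have "x \<noteq> y"
          proof
            assume "x = y"
            then obtain i where "i \<in> G0 \<inter> G1"
              using True ultrafilter_disjoint[OF beta[OF xy(1)], of G0 G1] by blast
            then obtain m n a b where ab: "i \<in> U a" "a \<in> L m" "i \<in> U b" "b \<in> K n - L n"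
              unfolding G0_def G1_def by blast
            have "m = n" using f[OF LK[OF ab(2)] ab(1)] f[of b n i] ab(3,4) by simp
            then have "a \<noteq> b" using ab(2,4) by blast
            then show False using U(2)[of a m b n] LK[OF ab(2)] ab by blast
          qed
          moreover have "A1 \<notin> \<A>"
            using I(2)[of A1] star_x(1) G_I[OF G(1)] A(2) by blast
          ultimately have "filtermap f x \<noteq> filtermap f y"
            using \<A>(2)[of A1 A2] A star_x(1) star_y(1) by blast
          \<comment> \<open>Separating the images separates the points compatibly with the humps: a
            pair in \<open>C\<close> has one common index \<open>n\<close>, which would have to lie
            both in \<open>J\<close> and in its complement.\<close>
          then obtain J where J: "J \<in>\<^sub>F filtermap f x" "- J \<in>\<^sub>F filtermap f y"
            using ultrafilter_neq omega_starD star_x(1) star_y(1) by blast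
          show ?thesis
          proof (rule emptyI[of "f -` J" "f -` (- J)"])
            fix x' y' assume xy': "x' \<in> Y" "y' \<in> Y" "f -` J \<in>\<^sub>F x'" "f -` (- J) \<in>\<^sub>F y'"
            show "C x' y' = {}"
            proof (rule ccontr)
              assume "C x' y' \<noteq> {}"
              then obtain a b n where ab: "U a \<in>\<^sub>F x'" "U b \<in>\<^sub>F y'" "a \<in> K n" "b \<in> K n"
                unfolding C_def using LK by blast
              obtain i where "i \<in> f -` J \<inter> U a"
                using ultrafilter_disjoint[OF beta[OF xy'(1)] xy'(3) ab(1)] by blast
              moreover obtain j where "j \<in> f -` (- J) \<inter> U b"
                using ultrafilter_disjoint[OF beta[OF xy'(2)] xy'(4) ab(2)] by blast
              ultimately show False using f[OF ab(3)] f[OF ab(4)] by auto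
            qed
          qed (use J in \<open>auto simp: eventually_filtermap\<close>)
        qed
      qed
    qed
    then show "\<exists>A B. A \<in>\<^sub>F x \<and> B \<in>\<^sub>F y \<and>
        (\<forall>x'\<in>Y. \<forall>y'\<in>Y. A \<in>\<^sub>F x' \<longrightarrow> B \<in>\<^sub>F y' \<longrightarrow> F (x', y') = F (x, y))"
      unfolding F_def by fastforce
  qed
  moreover have "\<bar>F (x, y)\<bar> \<le> 1" if xy: "x \<in> Y" "y \<in> Y" for x y
  proof (cases "C x y = {}")
    case False
    then obtain a b n where "U a \<in>\<^sub>F x" "U b \<in>\<^sub>F y" "a \<in> K n" "b \<in> K n"
      unfolding C_def using LK by blast
    from C_at[OF xy this] show ?thesis using \<sigma> by (simp add: F_def)
  qed (simp add: F_def)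
  moreover have "F (x, y) = (if x \<in> L n \<and> y \<notin> L n then \<sigma> (x, y) else 0)"
    if "n \<in> I" "x \<in> K n" "y \<in> K n" for n x y
  proof -
    have "(\<exists>m\<in>I. x \<in> L m \<and> y \<in> K m - L m) \<longleftrightarrow> x \<in> L n \<and> y \<notin> L n"
      using that LK K_unique by blast
    moreover have "x \<in> Y" "y \<in> Y" using that K(3) by blast+
    ultimately show ?thesis
      using C_at[of x y x y n n] that U(1) by (simp add: F_def)
  qed
  ultimately show ?thesis using I(1) by blast
qed

text \<open>Null slices mean that little mass lies on the lines through any fixed finite set, so a
  gliding hump moves the off-diagonal mass into squares \<open>K n \<times> K n\<close>. A large cut
  retains at least a quarter of it on \<open>L n \<times> (K n - L n)\<close>, where a continuous
  function with the right signs exists.\<close>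

lemma null_measures_off_diagonal:
  fixes u :: "nat set \<Rightarrow> nat filter" and \<mu> :: "nat \<Rightarrow> nat filter \<times> nat filter \<Rightarrow> real"
  assumes weak: "\<And>A. A \<in> infinite_subsets \<Longrightarrow> weak_P_point (u A)"
    and incomparable: "\<And>f1 f2 :: nat \<Rightarrow> nat.
           \<exists>\<A>. \<A> \<subseteq> infinite_subsets \<and> \<A> \<prec> (UNIV :: nat set set) \<and>
             (\<forall>A1 \<in> infinite_subsets - \<A>. \<forall>A2 \<in> infinite_subsets - {A1}.
                filtermap f1 (u A1) \<in> omega_star \<and> filtermap f2 (u A2) \<in> omega_star \<longrightarrow>
                filtermap f1 (u A1) \<noteq> filtermap f2 (u A2))"
    and Y: "Y = omega_points \<union> u ` infinite_subsets"
    and fin: "\<And>n. finite (S n)" and S: "\<And>n. S n \<subseteq> Y \<times> Y"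
    and zero: "\<And>n z. z \<notin> S n \<Longrightarrow> \<mu> n z = 0"
    and conv: "\<And>F. locally_constant_on Y F \<Longrightarrow> (\<forall>z\<in>Y \<times> Y. \<bar>F z\<bar> \<le> 1) \<Longrightarrow>
        (\<lambda>n. \<Sum>z\<in>S n. \<mu> n z * F z) \<longlonglongrightarrow> 0"
  shows "(\<lambda>n. \<Sum>z\<in>S n - Id. \<bar>\<mu> n z\<bar>) \<longlonglongrightarrow> 0"
proof (rule ccontr)
  have pts: "x \<in> omega_points \<or> weak_P_point x" if "x \<in> Y" for x
    using that Y weak by blast
  have beta: "Y \<subseteq> beta_omega"
    using Y weak weak_P_pointD omega_starD omega_points_subset_beta_omega by blast
  have rect: "(\<lambda>n. \<Sum>z\<in>S n. \<mu> n z * of_bool (A \<in>\<^sub>F fst z \<and> B \<in>\<^sub>F snd z)) \<longlonglongrightarrow> 0" for A B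
    by (rule conv[OF locally_constant_on_rectangle[OF beta]]) auto
  have slice1: "(\<lambda>n. \<Sum>y\<in>snd ` S n. \<bar>\<mu> n (a, y)\<bar>) \<longlonglongrightarrow> 0" for a
    by (rule null_measures_slice[OF fin _ zero rect]) (use S pts in auto)
  have slice2: "(\<lambda>n. \<Sum>y\<in>fst ` S n. \<bar>\<mu> n (y, a)\<bar>) \<longlonglongrightarrow> 0" for a
  proof -
    have "(\<lambda>n. \<Sum>y\<in>snd ` (prod.swap ` S n). \<bar>(\<mu> n \<circ> prod.swap) (a, y)\<bar>) \<longlonglongrightarrow> 0"
    proof (rule null_measures_slice)
      show "(\<lambda>n. \<Sum>z\<in>prod.swap ` S n. (\<mu> n \<circ> prod.swap) z * of_bool (A \<in>\<^sub>F fst z \<and> B \<in>\<^sub>F snd z)) \<longlonglongrightarrow> 0" for A B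
        using rect[of B A] by (simp add: sum.reindex conj_commute)
      show "(\<mu> n \<circ> prod.swap) z = 0" if "z \<notin> prod.swap ` S n" for n z
        using that zero[of "prod.swap z" n] by (metis comp_apply image_eqI swap_swap)
    qed (use fin S pts in auto)
    then show ?thesis by (simp add: image_image)
  qed
  assume "\<not> ?thesis"
  then obtain \<delta> r where r: "\<delta> > 0" "strict_mono (r :: nat \<Rightarrow> nat)"
    "\<And>n. \<delta> \<le> \<bar>\<Sum>z\<in>S (r n) - Id. \<bar>\<mu> (r n) z\<bar>\<bar>"
    by (rule not_tendsto_zeroE) blast
  have r3: "\<delta> \<le> (\<Sum>z\<in>S (r n) - Id. \<bar>\<mu> (r n) z\<bar>)" for n
    using r(3)[of n] by (simp add: sum_nonneg)
  define T where "T n = fst ` S (r n) \<union> snd ` S (r n)" for n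
  \<comment> \<open>The mass on the cross of all horizontal and vertical lines through
    \<open>F\<close>, bounded below by finitely many slices from each direction.\<close>
  define M where "M n F = (\<Sum>z\<in>{z\<in>S (r n). fst z \<in> F \<or> snd z \<in> F}. \<bar>\<mu> (r n) z\<bar>)" for n F
  have M_null: "(\<lambda>n. M n F) \<longlonglongrightarrow> 0" if F: "finite F" for F
  proof (rule tendsto_sandwich[OF _ _ tendsto_const])
    let ?b = "\<lambda>n. (\<Sum>a\<in>F. \<Sum>y\<in>snd ` S n. \<bar>\<mu> n (a, y)\<bar>) + (\<Sum>a\<in>F. \<Sum>x\<in>fst ` S n. \<bar>\<mu> n (x, a)\<bar>)"
    have "?b \<longlonglongrightarrow> 0"
      by (intro tendsto_add_zero tendsto_null_sum slice1 slice2)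
    then show "(\<lambda>n. ?b (r n)) \<longlonglongrightarrow> 0"
      using LIMSEQ_subseq_LIMSEQ[OF _ r(2)] by (force simp: o_def)
    have "M n F \<le> ?b (r n)" for n
    proof -
      let ?A = "{z\<in>S (r n). fst z \<in> F}" and ?B = "{z\<in>S (r n). snd z \<in> F}"
      have "M n F \<le> (\<Sum>z\<in>?A. \<bar>\<mu> (r n) z\<bar>) + (\<Sum>z\<in>?B. \<bar>\<mu> (r n) z\<bar>)"
      proof -
        have "{z\<in>S (r n). fst z \<in> F \<or> snd z \<in> F} = ?A \<union> ?B" by auto
        then show ?thesis
          unfolding M_def using fin sum_abs_Un_le[of ?A ?B] by simp
      qed
      also have "(\<Sum>z\<in>?A. \<bar>\<mu> (r n) z\<bar>) \<le> (\<Sum>z\<in>F \<times> snd ` S (r n). \<bar>\<mu> (r n) z\<bar>)"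
        using fin F by (intro sum_mono2) (auto intro: rev_image_eqI)
      also have "(\<Sum>z\<in>?B. \<bar>\<mu> (r n) z\<bar>) \<le> (\<Sum>z\<in>fst ` S (r n) \<times> F. \<bar>\<mu> (r n) z\<bar>)"
        using fin F by (intro sum_mono2) (auto intro: rev_image_eqI)
      also have "(\<Sum>z\<in>fst ` S (r n) \<times> F. \<bar>\<mu> (r n) z\<bar>) = (\<Sum>a\<in>F. \<Sum>x\<in>fst ` S (r n). \<bar>\<mu> (r n) (x, a)\<bar>)"
        by (subst sum.swap) (simp add: sum.cartesian_product case_prod_beta)
      also have "(\<Sum>z\<in>F \<times> snd ` S (r n). \<bar>\<mu> (r n) z\<bar>) = (\<Sum>a\<in>F. \<Sum>y\<in>snd ` S (r n). \<bar>\<mu> (r n) (a, y)\<bar>)"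
        by (simp add: sum.cartesian_product case_prod_beta)
      finally show ?thesis by simp
    qed
    then show "\<forall>\<^sub>F n in sequentially. M n F \<le> ?b (r n)" by simp
    show "\<forall>\<^sub>F n in sequentially. 0 \<le> M n F" by (simp add: M_def sum_nonneg)
  qed
  have T: "finite (T n)" "T n \<subseteq> Y" for n using fin S[of "r n"] by (auto simp: T_def)
  have \<epsilon>: "\<delta> / 8 > 0" using r(1) by simp
  have "\<exists>s G U. strict_mono (s :: nat \<Rightarrow> nat) \<and> (\<forall>n. M (s n) (G n) < \<delta> / 8) \<and>
      disjoint_family (\<lambda>n. T (s n) - G n) \<and> (\<forall>n. \<forall>x\<in>T (s n) - G n. U x \<in>\<^sub>F x) \<and>
      (\<forall>x\<in>(\<Union>n. T (s n) - G n). \<forall>y\<in>(\<Union>n. T (s n) - G n). x \<noteq> y \<longrightarrow> U x \<inter> U y = {})"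
    by (rule gliding_hump_disjoint_neighbourhoods) (fact T(1) M_null \<epsilon> | use T(2) pts in blast)+
  then obtain s G U where s: "strict_mono (s :: nat \<Rightarrow> nat)" "\<forall>n. M (s n) (G n) < \<delta> / 8"
    "disjoint_family (\<lambda>n. T (s n) - G n)"
    and U': "\<forall>n. \<forall>x\<in>T (s n) - G n. U x \<in>\<^sub>F x"
      "\<forall>x\<in>(\<Union>n. T (s n) - G n). \<forall>y\<in>(\<Union>n. T (s n) - G n). x \<noteq> y \<longrightarrow> U x \<inter> U y = {}"
    by (elim exE conjE)
  have U: "\<And>n x. x \<in> T (s n) - G n \<Longrightarrow> U x \<in>\<^sub>F x"
    "\<And>m n x y. x \<in> T (s m) - G m \<Longrightarrow> y \<in> T (s n) - G n \<Longrightarrow> x \<noteq> y \<Longrightarrow> U x \<inter> U y = {}"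
    using U' by blast+
  define N where "N n = r (s n)" for n
  have N: "strict_mono N" using r(2) s(1) by (simp add: strict_mono_def N_def)
  define K where "K n = T (s n) - G n" for n
  have finK: "finite (K n)" for n using T(1) by (simp add: K_def)
  have "\<forall>n. \<exists>L\<subseteq>K n. (\<Sum>x\<in>K n. \<Sum>y\<in>K n - {x}. \<bar>\<mu> (N n) (x, y)\<bar>)
      \<le> 4 * (\<Sum>x\<in>L. \<Sum>y\<in>K n - L. \<bar>\<mu> (N n) (x, y)\<bar>)"
    using ex_large_cut[OF finK, of _ "\<lambda>x y. \<bar>\<mu> (N _) (x, y)\<bar>"] by blast
  then obtain L where "\<forall>n. L n \<subseteq> K n \<and> (\<Sum>x\<in>K n. \<Sum>y\<in>K n - {x}. \<bar>\<mu> (N n) (x, y)\<bar>)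
      \<le> 4 * (\<Sum>x\<in>L n. \<Sum>y\<in>K n - L n. \<bar>\<mu> (N n) (x, y)\<bar>)"
    by (rule choice[THEN exE])
  then have L: "L n \<subseteq> K n" "(\<Sum>x\<in>K n. \<Sum>y\<in>K n - {x}. \<bar>\<mu> (N n) (x, y)\<bar>)
      \<le> 4 * (\<Sum>x\<in>L n. \<Sum>y\<in>K n - L n. \<bar>\<mu> (N n) (x, y)\<bar>)" for n
    by blast+
  have K_unique: "m = n" if "x \<in> K m" "x \<in> K n" for x m n
    using that s(3) unfolding disjoint_family_on_def K_def by blast
  \<comment> \<open>Since the \<open>K n\<close> are disjoint, the first coordinate determines the
    index, and one function can record the signs of all the measures.\<close>
  define \<sigma> where "\<sigma> z = sgn (\<mu> (N (THE n. fst z \<in> K n)) z)" for z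
  have \<sigma>: "\<sigma> (x, y) = sgn (\<mu> (N n) (x, y))" if "x \<in> K n" for x y n
  proof -
    have "(THE m. x \<in> K m) = n" by (rule the_equality) (use that K_unique in blast)+
    then show ?thesis by (simp add: \<sigma>_def)
  qed
  have \<sigma>_le: "\<bar>\<sigma> z\<bar> \<le> 1" for z by (simp add: \<sigma>_def abs_sgn_eq)
  have K_disj: "disjoint_family K" using s(3) by (simp add: K_def[abs_def])
  have KY: "K n \<subseteq> Y" for n using T(2) by (auto simp: K_def)
  have "\<exists>I F. infinite I \<and> locally_constant_on Y F \<and> (\<forall>x\<in>Y. \<forall>y\<in>Y. \<bar>F (x, y)\<bar> \<le> 1) \<and>
      (\<forall>n\<in>I. \<forall>x\<in>K n. \<forall>y\<in>K n. F (x, y) = (if x \<in> L n \<and> y \<notin> L n then \<sigma> (x, y) else 0))"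
    by (rule off_diagonal_function[OF weak incomparable Y finK K_disj KY U[folded K_def] L(1) \<sigma>_le])
  then obtain I F where I: "infinite I" "locally_constant_on Y F"
    "\<forall>x\<in>Y. \<forall>y\<in>Y. \<bar>F (x, y)\<bar> \<le> 1"
    "\<forall>n\<in>I. \<forall>x\<in>K n. \<forall>y\<in>K n. F (x, y) = (if x \<in> L n \<and> y \<notin> L n then \<sigma> (x, y) else 0)"
    by (elim exE conjE)
  define g where "g n = (\<Sum>z\<in>S n. \<mu> n z * F z)" for n
  have "g \<longlonglongrightarrow> 0" unfolding g_def by (rule conv) (use I in auto)
  \<comment> \<open>The cross over \<open>G n\<close> has mass below \<open>\<delta> / 8\<close>, so
    the cut carries more than \<open>7 * \<delta> / 32\<close>; subtracting the error
    \<open>\<delta> / 8\<close> leaves more than \<open>3 * \<delta> / 32\<close>.\<close>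
  moreover have "\<delta> / 16 \<le> \<bar>g (N n)\<bar>" if n: "n \<in> I" for n
  proof -
    let ?S = "S (N n)" and ?\<mu> = "\<mu> (N n)" and ?m = "M (s n) (G n)"
    define R where "R = {z\<in>?S. fst z \<in> G n \<or> snd z \<in> G n}"
    have R: "?S - R \<subseteq> K n \<times> K n"
      by (auto simp: R_def K_def T_def N_def intro: rev_image_eqI)
    have m: "?m = (\<Sum>z\<in>R. \<bar>?\<mu> z\<bar>)" by (simp add: M_def R_def N_def)
    have "\<delta> \<le> (\<Sum>z\<in>?S - Id. \<bar>?\<mu> z\<bar>)" using r3 by (simp add: N_def)
    also have "\<dots> \<le> (\<Sum>z\<in>R \<union> (K n \<times> K n - Id). \<bar>?\<mu> z\<bar>)"
      using R fin finK by (intro sum_mono2) (auto simp: R_def)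
    also have "\<dots> \<le> ?m + (\<Sum>z\<in>K n \<times> K n - Id. \<bar>?\<mu> z\<bar>)"
      unfolding m using fin finK by (intro sum_abs_Un_le) (auto simp: R_def)
    also have "K n \<times> K n - Id = (SIGMA x:K n. K n - {x})" by auto
    also have "(\<Sum>z\<in>\<dots>. \<bar>?\<mu> z\<bar>) = (\<Sum>x\<in>K n. \<Sum>y\<in>K n - {x}. \<bar>?\<mu> (x, y)\<bar>)"
      using finK by (subst sum.Sigma) (auto simp: case_prod_beta)
    finally have "\<delta> \<le> ?m + 4 * (\<Sum>x\<in>L n. \<Sum>y\<in>K n - L n. \<bar>?\<mu> (x, y)\<bar>)"
      using L(2)[of n] by linarith
    moreover have "g (N n) = (\<Sum>x\<in>L n. \<Sum>y\<in>K n - L n. \<bar>?\<mu> (x, y)\<bar>) + (\<Sum>z\<in>R. ?\<mu> z * F z)"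
    proof -
      have "g (N n) = (\<Sum>z\<in>R. ?\<mu> z * F z) + (\<Sum>z\<in>?S - R. ?\<mu> z * F z)"
        unfolding g_def using fin by (subst sum.subset_diff[of R]) (auto simp: R_def)
      moreover have "(\<Sum>z\<in>?S - R. ?\<mu> z * F z) = (\<Sum>z\<in>K n \<times> K n. ?\<mu> z * F z)"
      proof (intro sum.mono_neutral_left ballI)
        fix z assume "z \<in> K n \<times> K n - (?S - R)"
        moreover have "R \<inter> K n \<times> K n = {}" by (auto simp: R_def K_def)
        ultimately have "z \<notin> ?S" by blast
        then show "?\<mu> z * F z = 0" using zero by simp
      qed (use finK R in auto)
      moreover have "\<dots> = (\<Sum>z\<in>L n \<times> (K n - L n). \<bar>?\<mu> z\<bar>)"
        using L(1)[of n] finK I(4)[rule_format, OF n] \<sigma>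
        by (intro sum.mono_neutral_cong_right) (auto simp: abs_sgn split: if_splits)
      ultimately show ?thesis by (simp add: sum.cartesian_product case_prod_beta)
    qed
    moreover have "\<bar>\<Sum>z\<in>R. ?\<mu> z * F z\<bar> \<le> ?m"
      unfolding m
    proof (rule order_trans[OF sum_abs], rule sum_mono)
      fix z assume "z \<in> R"
      then have "\<bar>F z\<bar> \<le> 1" using I(3) S[of "N n"] by (cases z) (auto simp: R_def)
      then show "\<bar>?\<mu> z * F z\<bar> \<le> \<bar>?\<mu> z\<bar>" by (simp add: abs_mult mult_left_le)
    qed
    ultimately show ?thesis using s(2)[rule_format, of n] by simp
  qed
  ultimately show False
    using tendsto_zero_infinite_contradiction[OF _ N I(1), of g "\<delta> / 16"] r(1) by auto
qed

section \<open>The diagonal part and the conclusion for the square of \<open>X\<close>\<close>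

theorem theorem5p8:
  fixes u :: "nat set \<Rightarrow> nat filter"
    and X :: "nat filter topology"
  assumes "\<And>A. A \<in> infinite_subsets \<Longrightarrow> weak_P_point (u A)"
    and "\<And>A. A \<in> infinite_subsets \<Longrightarrow> \<forall>\<^sub>F n in u A. n \<in> A"
    and "\<And>f1 f2 :: nat \<Rightarrow> nat.
           \<exists>\<A>. \<A> \<subseteq> infinite_subsets \<and> \<A> \<prec> (UNIV :: nat set set) \<and>
             (\<forall>A1 \<in> infinite_subsets - \<A>. \<forall>A2 \<in> infinite_subsets - {A1}.
                filtermap f1 (u A1) \<in> omega_star \<and> filtermap f2 (u A2) \<in> omega_star \<longrightarrow>
                filtermap f1 (u A1) \<noteq> filtermap f2 (u A2))"
    and "X = subtopology beta_omega_topology (omega_points \<union> u ` infinite_subsets)"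
  shows "\<not> Cp_BJNP (prod_topology X X) \<and> \<not> Cp_JNP (prod_topology X X)"
proof -
  have "\<not> Cp_BJNP (prod_topology X X)"
  proof
    define Y where "Y = omega_points \<union> u ` infinite_subsets"
    have beta: "Y \<subseteq> beta_omega"
      using Y_def assms(1) weak_P_pointD omega_starD omega_points_subset_beta_omega by blast
    have X: "X = subtopology beta_omega_topology Y" using assms(4) by (simp add: Y_def)
    have top: "topspace (prod_topology X X) = Y \<times> Y" using beta by (auto simp: X)
    assume "Cp_BJNP (prod_topology X X)"
    then obtain \<mu> where \<mu>: "\<And>n. fs_measure_on (prod_topology X X) (\<mu> n)" "\<And>n. fs_norm (\<mu> n) = 1"
      "\<And>f. continuous_map (prod_topology X X) euclideanreal f \<Longrightarrow> bounded (f ` (Y \<times> Y)) \<Longrightarrow>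
        (\<lambda>n. fs_integral (\<mu> n) f) \<longlonglongrightarrow> 0"
      unfolding Cp_BJNP_def top by blast
    define S where "S n = fs_supp (\<mu> n)" for n
    have S: "finite (S n)" "S n \<subseteq> Y \<times> Y" for n
      using \<mu>(1)[of n] unfolding fs_measure_on_def top by (auto simp: S_def)
    have zero: "\<mu> n z = 0" if "z \<notin> S n" for n z
      using that by (simp add: S_def fs_supp_def)
    have conv: "(\<lambda>n. \<Sum>z\<in>S n. \<mu> n z * F z) \<longlonglongrightarrow> 0"
      if "locally_constant_on Y F" "\<forall>z\<in>Y \<times> Y. \<bar>F z\<bar> \<le> 1" for F
    proof -
      have "bounded (F ` (Y \<times> Y))" unfolding bounded_iff using that(2) by auto
      then show ?thesis
        using \<mu>(3)[OF locally_constant_on_imp_continuous_map[OF beta that(1) X]]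
        by (simp add: fs_integral_def S_def)
    qed
    have off: "(\<lambda>n. \<Sum>z\<in>S n - Id. \<bar>\<mu> n z\<bar>) \<longlonglongrightarrow> 0"
      by (rule null_measures_off_diagonal[OF assms(1,3) Y_def S zero conv])
    \<comment> \<open>The diagonal is identified with the space itself, so that the diagonal part of
      a measure becomes a measure to which the Schur property applies.\<close>
    have diag: "(\<Sum>x\<in>fst ` S n. h (x, x)) = sum h (S n \<inter> Id)" if "\<And>z. z \<notin> S n \<Longrightarrow> h z = 0"
      for n and h :: "_ \<Rightarrow> real"
    proof -
      have "(\<Sum>x\<in>fst ` S n. h (x, x)) = (\<Sum>z\<in>(\<lambda>x. (x, x)) ` fst ` S n. h z)"
        by (subst sum.reindex) (auto intro: inj_onI)
      also have "\<dots> = sum h (S n \<inter> Id)"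
        using S(1) that by (intro sum.mono_neutral_right) (auto intro: rev_image_eqI)
      finally show ?thesis .
    qed
    have split: "sum h (S n) = sum h (S n \<inter> Id) + sum h (S n - Id)" for n and h :: "_ \<Rightarrow> real"
      using S(1) by (rule sum.Int_Diff)
    have "(\<lambda>n. \<Sum>x\<in>fst ` S n. \<bar>\<mu> n (x, x)\<bar>) \<longlonglongrightarrow> 0"
    proof (rule null_measures_norm)
      fix B
      \<comment> \<open>The condition with \<open>UNIV\<close> always holds: this is the indicator
        of the strip over \<open>B\<close>. Its integral differs from that of the diagonal part by
        at most the off-diagonal mass, which tends to 0.\<close>
      let ?h = "\<lambda>n z. \<mu> n z * of_bool (B \<in>\<^sub>F fst z \<and> UNIV \<in>\<^sub>F snd z)"
      have "(\<lambda>n. sum (?h n) (S n - Id)) \<longlonglongrightarrow> 0"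
      proof (rule tendsto_rabs_zero_cancel, rule tendsto_sandwich[OF _ _ tendsto_const off])
        have "\<bar>sum (?h n) (S n - Id)\<bar> \<le> (\<Sum>z\<in>S n - Id. \<bar>\<mu> n z\<bar>)" for n
          by (rule order_trans[OF sum_abs], rule sum_mono) (simp add: abs_mult mult_left_le)
        then show "\<forall>\<^sub>F n in sequentially. \<bar>sum (?h n) (S n - Id)\<bar> \<le> (\<Sum>z\<in>S n - Id. \<bar>\<mu> n z\<bar>)"
          by simp
      qed simp
      moreover have "(\<lambda>n. sum (?h n) (S n)) \<longlonglongrightarrow> 0"
        by (rule conv[OF locally_constant_on_rectangle[OF beta]]) auto
      ultimately have "(\<lambda>n. sum (?h n) (S n) - sum (?h n) (S n - Id)) \<longlonglongrightarrow> 0 - 0"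
        by (intro tendsto_diff)
      moreover have "(\<Sum>x\<in>fst ` S n. \<mu> n (x, x) * of_bool (B \<in>\<^sub>F x)) = sum (?h n) (S n \<inter> Id)" for n
        using diag[of n "?h n"] zero by simp
      ultimately show "(\<lambda>n. \<Sum>x\<in>fst ` S n. \<mu> n (x, x) * of_bool (B \<in>\<^sub>F x)) \<longlonglongrightarrow> 0"
        by (simp add: split)
    next
      fix n x assume "x \<notin> fst ` S n"
      then show "\<mu> n (x, x) = 0" using zero by (metis fst_conv image_eqI)
    next
      fix n x assume "x \<in> fst ` S n"
      then show "x \<in> omega_points \<or> weak_P_point x" using S(2)[of n] assms(1) by (auto simp: Y_def)
    qed (use S in auto)
    moreover have "(\<Sum>x\<in>fst ` S n. \<bar>\<mu> n (x, x)\<bar>) = (\<Sum>z\<in>S n \<inter> Id. \<bar>\<mu> n z\<bar>)" for n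
      using diag[of n "\<lambda>z. \<bar>\<mu> n z\<bar>"] zero by simp
    ultimately have "(\<lambda>n. (\<Sum>z\<in>S n \<inter> Id. \<bar>\<mu> n z\<bar>) + (\<Sum>z\<in>S n - Id. \<bar>\<mu> n z\<bar>)) \<longlonglongrightarrow> 0 + 0"
      using off by (intro tendsto_add) auto
    then have "(\<lambda>n. \<Sum>z\<in>S n. \<bar>\<mu> n z\<bar>) \<longlonglongrightarrow> 0" by (simp add: split)
    then show False using \<mu>(2) by (simp add: fs_norm_def S_def LIMSEQ_const_iff)
  qed
  \<comment> \<open>The same measures serve as witnesses, since the bounded property tests them on
    fewer functions.\<close>
  moreover have "Cp_BJNP Z" if "Cp_JNP Z" for Z :: "(nat filter \<times> nat filter) topology"
    using that unfolding Cp_JNP_def Cp_BJNP_def by blast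
  ultimately show ?thesis by blast
qed

end
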